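(* Let $Q$ be the Laplacian of an irreducible Markov chain on $[n]$ and let $(X_t)_{t\ge0}$ be the associated continuous-time Markov chain with rate matrix $Q$. Let $h>0$ and let $\zeta$ be an exponential random variable with mean $h^{-1}$, independent of the chain. Then for every $u:\mathbb{R}_+^n\to\mathbb{C}$ with property $\mathfrak{F}$, every $a\in[n]$ and every $r>0$, $$\bigg[\Big(\frac{\phi_a+\sqrt r}{\sqrt r}\Big)\,u\big(|\phi+\sqrt r\,\mathbf 1|^2\big)\bigg]_{\mu_{h\mathbf 1}}=\Big[\mathbb{E}_a^*\big[u\big(|\phi+\sqrt r\,\mathbf 1|^2+\mathcal L_\zeta\big)\big]\Big]_{\mu_{h\mathbf 1}} .$$
   Context: $[n]=\{1,\dots,n\}$, $\mathbb{R}_+=[0,\infty)$, $\mathbf 1$ is the all-ones vector, $|A|$ is the determinant of a matrix $A$. Laplacian: for an irreducible transition probability matrix $P$ on $[n]$ with stationary distribution $\pi$ and $\Pi=\mathrm{diag}(\pi)$, the Laplacian is $Q=\Pi(P-I)$ (so $Q\mathbf 1=0$ and $\mathbf 1^TQ=0$). $\mathbb{E}_a^*$ denotes expectation for the reversed chain, i.e. the continuous-time chain with rate matrix $Q^T$, started at $a$ (with $\zeta$ independent of it). Local times: $\mathcal L_t^i=\int_0^t\mathbf 1\{X_s=i\}\,ds$, $\mathcal L_t=(\mathcal L_t^i)_{i\in[n]}$. For $z\in\mathbb{C}^n$, $|z|^2:=(|z_i|^2)_{i\in[n]}$ coordinatewise; $\langle\phi,\psi\rangle:=\sum_i\phi_i\psi_i$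 (no conjugation). $[\,\cdot\,]_{\mu_{h\mathbf 1}}$ denotes integration over $\phi\in\mathbb{C}^n$ with respect to the normalized complex measure $$d\mu_{h\mathbf 1}(\phi)=\pi_0^{-n}\,|hI-Q|\;e^{\langle\phi,(Q-hI)\bar\phi\rangle}\,du\,dv,\qquad \phi=u+\mathrm{i}v,\ u,v\in\mathbb{R}^n,$$ where $\pi_0=3.14159\ldots$ (in the paper's notation, $\frac{1}{(2\pi\mathrm{i})^n|G_h|}e^{\langle\phi,Q_h\bar\phi\rangle}d\bar\phi\,d\phi$ with $Q_h=Q-hI$, $G_h=(-Q_h)^{-1}$). Property $\mathfrak{F}$: $u\in C^\infty(\mathbb{R}_+^n)$, and $u$ and all its partial derivatives of all orders have sub-polynomial tails, where a function $f$ has sub-polynomial tails if for every $d>0$ there is a constant $c_d>0$ with $|f(l)|\le c_d\|l\|^{-d}$. *)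

theory Defs
  imports "HOL-Probability.Probability"
begin

section \<open>Finite Markov chains and their Laplacians\<close>

text \<open>The index set \<open>[n]\<close> is a finite type \<^typ>\<open>'n\<close>; rows of a matrix are indexed by the
  current state, so probability vectors act from the left.\<close>

definition mat_power :: "'a::comm_semiring_1^'n^'n \<Rightarrow> nat \<Rightarrow> 'a^'n^'n" where
  "mat_power A k = (((**) A) ^^ k) (mat 1)"

definition transition_matrix :: "real^'n^'n \<Rightarrow> bool" where
  "transition_matrix P \<longleftrightarrow> (\<forall>i j. 0 \<le> P $ i $ j) \<and> (\<forall>i. (\<Sum>j\<in>UNIV. P $ i $ j) = 1)"

definition irreducible_matrix :: "real^'n^'n \<Rightarrow> bool" where
  "irreducible_matrix P \<longleftrightarrow> (\<forall>i j. \<exists>k. 0 < mat_power P k $ i $ j)"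

definition stationary_distribution :: "real^'n^'n \<Rightarrow> real^'n \<Rightarrow> bool" where
  "stationary_distribution P p \<longleftrightarrow>
     (\<forall>i. 0 \<le> p $ i) \<and> (\<Sum>i\<in>UNIV. p $ i) = 1 \<and> p v* P = p"

definition diag_matrix :: "'a::zero^'n \<Rightarrow> 'a^'n^'n" where
  "diag_matrix v = (\<chi> i j. if i = j then v $ i else 0)"

definition is_laplacian :: "real^'n^'n \<Rightarrow> bool" where
  "is_laplacian Q \<longleftrightarrow>
     (\<exists>P p. transition_matrix P \<and> irreducible_matrix P \<and> stationary_distribution P p \<and>
            Q = diag_matrix p ** (P - mat 1))"

section \<open>Continuous-time Markov chains and local times\<close>

text \<open>The matrix exponential \<open>exp (t A)\<close>. The product on the vector type is componentwise,
  so the library's powers and exponential of type class elements are not the matrix ones.\<close>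

definition transition_semigroup :: "real^'n^'n \<Rightarrow> real \<Rightarrow> real^'n^'n" where
  "transition_semigroup A t = (\<Sum>k. (t ^ k / fact k) *\<^sub>R mat_power A k)"

text \<open>A process with right-continuous paths (for the discrete topology on the state space)
  whose finite-dimensional distributions are those of the Markov chain with rate matrix \<open>A\<close>;
  the initial law is left free. Only times \<open>t \<ge> 0\<close> matter.\<close>

definition markov_chain :: "'w measure \<Rightarrow> (real \<Rightarrow> 'w \<Rightarrow> 'n::finite) \<Rightarrow> real^'n^'n \<Rightarrow> bool" where
  "markov_chain M X A \<longleftrightarrow>
     prob_space M \<and>
     (\<forall>t\<ge>0. X t \<in> measurable M (count_space UNIV)) \<and>
     (\<forall>\<omega>\<in>space M. \<forall>t\<ge>0. \<forall>\<^sub>F s in at_right t. X s \<omega> = X t \<omega>) \<and>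
     (\<forall>k (t :: nat \<Rightarrow> real) (x :: nat \<Rightarrow> 'n). 0 \<le> t 0 \<longrightarrow> (\<forall>m<k. t m \<le> t (Suc m)) \<longrightarrow>
        measure M {\<omega> \<in> space M. \<forall>m\<le>k. X (t m) \<omega> = x m} =
        measure M {\<omega> \<in> space M. X (t 0) \<omega> = x 0} *
        (\<Prod>m<k. transition_semigroup A (t (Suc m) - t m) $ x m $ x (Suc m)))"

text \<open>The random variable \<open>Z\<close> is independent of the sigma-algebra generated by all \<open>X t\<close>, \<open>t \<ge> 0\<close>.
  (The library's \<open>indep_var\<close> requires both variables to have the same type.)\<close>

definition independent_of_process ::
  "'w measure \<Rightarrow> (real \<Rightarrow> 'w \<Rightarrow> 'n) \<Rightarrow> ('w \<Rightarrow> real) \<Rightarrow> bool" where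
  "independent_of_process M X Z \<longleftrightarrow>
     prob_space.indep_set M
       (sets (vimage_algebra (space M) (\<lambda>\<omega>. \<lambda>t\<in>{0..}. X t \<omega>) (PiM {0..} (\<lambda>_. count_space UNIV))))
       (sets (vimage_algebra (space M) Z borel))"

definition local_time :: "(real \<Rightarrow> 'w \<Rightarrow> 'n) \<Rightarrow> real \<Rightarrow> 'w \<Rightarrow> real^'n" where
  "local_time X t \<omega> = (\<chi> i. LINT s:{0..t}|lborel. indicator {i} (X s \<omega>))"

section \<open>The complex Gaussian measure\<close>

definition pairing :: "complex^'n \<Rightarrow> complex^'n \<Rightarrow> complex" where
  "pairing \<phi> \<psi> = (\<Sum>i\<in>UNIV. \<phi> $ i * \<psi> $ i)"

definition cnj_vec :: "complex^'n \<Rightarrow> complex^'n" where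
  "cnj_vec \<phi> = (\<chi> i. cnj (\<phi> $ i))"

definition cmod2_vec :: "complex^'n \<Rightarrow> real^'n" where
  "cmod2_vec \<phi> = (\<chi> i. (cmod (\<phi> $ i))\<^sup>2)"

text \<open>Here \<^term>\<open>mat h\<close> is \<open>h\<close> times the identity. On \<^typ>\<open>complex^'n\<close>, \<^const>\<open>lborel\<close> is
  Lebesgue measure \<open>du dv\<close> on real and imaginary parts.\<close>

definition gauss_density :: "real^'n^'n \<Rightarrow> real \<Rightarrow> complex^'n \<Rightarrow> complex" where
  "gauss_density Q h \<phi> =
     complex_of_real (det (mat h - Q) / pi ^ CARD('n)) *
     exp (pairing \<phi> (map_matrix complex_of_real (Q - mat h) *v cnj_vec \<phi>))"

definition gauss_integral :: "real^'n^'n \<Rightarrow> real \<Rightarrow> (complex^'n \<Rightarrow> complex) \<Rightarrow> complex" where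
  "gauss_integral Q h F = (\<integral>\<phi>. F \<phi> * gauss_density Q h \<phi> \<partial>lborel)"

section \<open>Smooth functions on the orthant with sub-polynomial tails\<close>

definition orthant :: "(real^'n) set" where
  "orthant = {l. \<forall>i. 0 \<le> l $ i}"

text \<open>Restriction of \<open>f\<close> to the line through \<open>l\<close> in direction \<open>i\<close>, parametrised by the \<open>i\<close>-th
  coordinate. Partial derivatives on the closed orthant are taken within \<open>{0..}\<close>, so they are
  one-sided on the boundary and never see values outside the orthant.\<close>

definition coord_line :: "(real^'n \<Rightarrow> complex) \<Rightarrow> 'n \<Rightarrow> real^'n \<Rightarrow> real \<Rightarrow> complex" where
  "coord_line f i l s = f (\<chi> j. if j = i then s else l $ j)"

definition partial_deriv :: "'n \<Rightarrow> (real^'n \<Rightarrow> complex) \<Rightarrow> real^'n \<Rightarrow> complex" where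
  "partial_deriv i f l = vector_derivative (coord_line f i l) (at (l $ i) within {0..})"

definition iterated_partial :: "'n list \<Rightarrow> (real^'n \<Rightarrow> complex) \<Rightarrow> real^'n \<Rightarrow> complex" where
  "iterated_partial is f = foldr partial_deriv is f"

definition smooth_on_orthant :: "(real^'n \<Rightarrow> complex) \<Rightarrow> bool" where
  "smooth_on_orthant u \<longleftrightarrow>
     (\<forall>is. continuous_on orthant (iterated_partial is u) \<and>
       (\<forall>l\<in>orthant. \<forall>i.
          coord_line (iterated_partial is u) i l differentiable (at (l $ i) within {0..})))"

text \<open>The bound is void at the origin, where \<open>\<parallel>l\<parallel>\<^sup>-\<^sup>d\<close> is infinite; this has to be said since
  \<open>0 powr (- d) = 0\<close>.\<close>

definition sub_polynomial_tails :: "(real^'n \<Rightarrow> complex) \<Rightarrow> bool" where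
  "sub_polynomial_tails f \<longleftrightarrow>
     (\<forall>d>0. \<exists>c>0. \<forall>l\<in>orthant - {0}. cmod (f l) \<le> c * norm l powr (- d))"

definition property_F :: "(real^'n \<Rightarrow> complex) \<Rightarrow> bool" where
  "property_F u \<longleftrightarrow>
     smooth_on_orthant u \<and> (\<forall>is. sub_polynomial_tails (iterated_partial is u))"

end

theory Submission
  imports Defs
begin

text \<open>Both sides are continuous in \<open>u\<close> for the supremum norm on the orthant, so by Stone--Weierstrass it is
  enough to treat \<open>u l = exp (- (v \<bullet> l))\<close> with \<open>v \<ge> 0\<close>. Write \<open>A = h - Q\<close>, \<open>V = diag v\<close> and \<open>\<psi> = \<phi> + \<surd>r\<close>.
  Gaussian integration by parts shows that the vector of moments \<open>m i = [\<psi> i * u (|\<psi>|\<^sup>2)]\<close> satisfies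
  \<open>(A\<^sup>T + V) m = h \<surd>r [u (|\<psi>|\<^sup>2)] 1\<close>; only the column sums of \<open>Q\<close> enter. The Feynman--Kac formula
  says that the killed Green function \<open>\<gamma> b = \<integral> exp (- h t) E\<^sub>a\<^sup>* [1{X t = b} exp (- (v \<bullet> L t))] dt\<close> satisfies
  \<open>\<gamma> (A\<^sup>T + V) = e\<^sub>a\<close>, and \<open>E\<^sub>a\<^sup>* [exp (- (v \<bullet> L \<zeta>))] = h (\<Sum>b. \<gamma> b)\<close>. Pairing the first equation
  with \<open>\<gamma>\<close> gives the claim.\<close>

section \<open>The transition semigroup and its resolvent\<close>

text \<open>The chain is given only by finite-dimensional distributions and right-continuous paths,
  and the semigroup is a matrix series, so the Feynman--Kac formula has to be built from these.
  Hence the weight is approximated by functions of finitely many path values, and sign and size of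
  semigroup entries are read off from probabilities. Since \<open>v $ X t \<omega>\<close> jumps in
  \<open>t\<close>, \<gamma> does not come from a differential equation in time: a pathwise identity
  for \<open>exp (- (v \<bullet> L t))\<close> and the Markov property give, after a Laplace
  transform, the perturbation identity \<open>R = \<gamma> + \<gamma> V R\<close> for row
  \<open>a\<close> of the free resolvent, and multiplication by \<open>h - Q\<^sup>T\<close> from
  the right yields the equation for \<gamma>. It contains the same matrix as the moment equation,
  which is why pairing suffices and no inverse is taken. On the Gaussian side \<open>Q\<close> may
  fail to be symmetric, so the density is complex; row sums and stationarity bound the real part of
  its exponent by \<open>- h * (norm \<phi>)\<^sup>2\<close>.\<close>

lemma mat_power_0 [simp]: "mat_power A 0 = mat 1"
  by (simp add: mat_power_def)

lemma mat_power_Suc: "mat_power A (Suc k) = A ** mat_power A k"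
  by (simp add: mat_power_def)

lemma mat_power_Suc_right: "mat_power A (Suc k) = mat_power A k ** A"
proof (induction k)
  case (Suc k)
  then show ?case
    by (metis mat_power_Suc matrix_mul_assoc)
qed (simp add: mat_power_Suc)

text \<open>The sum of the absolute values of all entries dominates every row sum, so it serves as a
  crude growth rate of the powers. Comparison with the exponential series then gives convergence for
  all times.\<close>

lemma mat_power_entry_bound:
  fixes A :: "real^'n^'n"
  shows "\<bar>mat_power A k $ i $ j\<bar> \<le> (\<Sum>i\<in>UNIV. \<Sum>j\<in>UNIV. \<bar>A $ i $ j\<bar>) ^ k"
proof (induction k arbitrary: i)
  case 0
  then show ?case by (simp add: mat_def)
next
  case (Suc k)
  let ?S = "\<Sum>i\<in>UNIV. \<Sum>j\<in>UNIV. \<bar>A $ i $ j\<bar>"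
  have S: "0 \<le> ?S" by (intro sum_nonneg) auto
  have "\<bar>mat_power A (Suc k) $ i $ j\<bar> \<le> (\<Sum>l\<in>UNIV. \<bar>A $ i $ l\<bar> * \<bar>mat_power A k $ l $ j\<bar>)"
    by (simp add: mat_power_Suc matrix_matrix_mult_def sum_abs flip: abs_mult)
  also have "\<dots> \<le> (\<Sum>l\<in>UNIV. \<bar>A $ i $ l\<bar> * ?S ^ k)"
    by (intro sum_mono mult_left_mono Suc) auto
  also have "\<dots> = (\<Sum>l\<in>UNIV. \<bar>A $ i $ l\<bar>) * ?S ^ k"
    by (simp add: sum_distrib_right)
  also have "\<dots> \<le> ?S * ?S ^ k"
    using S by (intro mult_right_mono member_le_sum) (auto intro: sum_nonneg)
  finally show ?case by simp
qed

text \<open>The matrix series is reduced to one scalar power series in \<open>t\<close> per entry,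
  so that termwise differentiation of power series becomes available.\<close>

lemma transition_semigroup_sums:
  fixes A :: "real^'n^'n"
  shows "(\<lambda>k. mat_power A k $ i $ j / fact k * t ^ k) sums (transition_semigroup A t $ i $ j)"
proof -
  let ?S = "\<Sum>i\<in>UNIV. \<Sum>j\<in>UNIV. \<bar>A $ i $ j\<bar>"
  let ?f = "\<lambda>k. (t ^ k / fact k) *\<^sub>R mat_power A k"
  have sm: "summable (\<lambda>k. ?f k $ i $ j)" for i j
  proof (rule summable_comparison_test')
    show "summable (\<lambda>k. (\<bar>t\<bar> * ?S) ^ k / fact k)"
      using summable_exp[of "\<bar>t\<bar> * ?S"] by (simp add: field_simps)
    fix k
    have "\<bar>t\<bar> ^ k * \<bar>mat_power A k $ i $ j\<bar> \<le> \<bar>t\<bar> ^ k * ?S ^ k"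
      by (intro mult_left_mono mat_power_entry_bound) auto
    then show "norm (?f k $ i $ j) \<le> (\<bar>t\<bar> * ?S) ^ k / fact k"
      by (simp add: abs_mult power_abs power_mult_distrib divide_right_mono)
  qed
  have "?f sums (\<chi> i j. \<Sum>k. ?f k $ i $ j)"
    unfolding sums_def
    using sm by (intro vec_tendstoI) (simp add: summable_LIMSEQ)
  then have "transition_semigroup A t = (\<chi> i j. \<Sum>k. ?f k $ i $ j)"
    unfolding transition_semigroup_def by (rule sums_unique[symmetric])
  then show ?thesis
    using sm[of i j] by (simp add: summable_sums field_simps)
qed

lemma transition_semigroup_0: "transition_semigroup (A :: real^'n^'n) 0 = mat 1"
proof -
  have "transition_semigroup A 0 $ i $ j = mat 1 $ i $ j" for i j
    using transition_semigroup_sums[of A i j 0] powser_sums_zero_iff[of "\<lambda>k. mat_power A k $ i $ j / fact k"]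
    by (simp add: mat_power_def)
  then show ?thesis by (simp add: vec_eq_iff)
qed

text \<open>This is the forward equation. The generator stands on the right, by
  \<open>mat_power_Suc_right\<close>, so each row of the semigroup satisfies a closed system; this
  matters because bounds will be known only for some rows.\<close>

lemma transition_semigroup_deriv:
  fixes A :: "real^'n^'n"
  shows "((\<lambda>t. transition_semigroup A t $ i $ j) has_real_derivative
           (\<Sum>d\<in>UNIV. transition_semigroup A t $ i $ d * A $ d $ j)) (at t)"
proof -
  define c where "c j k = mat_power A k $ i $ j / fact k" for j k
  have eq: "transition_semigroup A t $ i $ j = (\<Sum>k. c j k * t ^ k)" for t j
    using transition_semigroup_sums[of A i j t] by (simp add: sums_iff c_def)
  have sm: "summable (\<lambda>k. c j k * t ^ k)" for t j
    using transition_semigroup_sums[of A i j t] by (simp add: sums_iff c_def)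
  have "diffs (c j) k = (\<Sum>d\<in>UNIV. c d k * A $ d $ j)" for k
    by (simp add: diffs_def c_def mat_power_Suc_right matrix_matrix_mult_def sum_divide_distrib
        sum_distrib_left del: of_nat_Suc)
  then have "(\<Sum>k. diffs (c j) k * t ^ k) = (\<Sum>k. \<Sum>d\<in>UNIV. (c d k * t ^ k) * A $ d $ j)"
    by (simp add: sum_distrib_left mult_ac)
  also have "\<dots> = (\<Sum>d\<in>UNIV. \<Sum>k. (c d k * t ^ k) * A $ d $ j)"
    by (intro suminf_sum summable_mult2 sm)
  also have "\<dots> = (\<Sum>d\<in>UNIV. transition_semigroup A t $ i $ d * A $ d $ j)"
    by (simp add: suminf_mult2[OF sm, symmetric] eq)
  finally show ?thesis
    using termdiffs_strong_converges_everywhere[OF sm[of j], of t] by (simp add: eq)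
qed

section \<open>Laplace transforms on the half-line\<close>

lemma nn_integral_exp_minus:
  assumes "(h::real) > 0"
  shows "(\<integral>\<^sup>+x. ennreal (exp (- h * x)) * indicator {0..} x \<partial>lborel) = ennreal (1 / h)"
proof -
  have "((\<lambda>x. - (exp (- h * x) / h)) \<longlongrightarrow> - (0 / h)) at_top"
    using assms
    by (intro tendsto_intros filterlim_compose[OF exp_at_bot]
        filterlim_tendsto_neg_mult_at_bot[OF tendsto_const _ filterlim_ident]) auto
  then show ?thesis
    using assms
    by (subst nn_integral_FTC_atLeast[where F="\<lambda>x. - (exp (- h * x) / h)" and T=0])
       (auto intro!: derivative_eq_intros)
qed

lemma set_integrable_exp_minus:
  assumes "(h::real) > 0"
  shows "set_integrable lborel {0..} (\<lambda>x. exp (- h * x))"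
  unfolding set_integrable_def
proof (rule integrableI_nonneg)
  have "(\<integral>\<^sup>+x. ennreal (indicator {0..} x *\<^sub>R exp (- h * x)) \<partial>lborel) =
      (\<integral>\<^sup>+x. ennreal (exp (- h * x)) * indicator {0..} x \<partial>lborel)"
    by (intro nn_integral_cong) (auto split: split_indicator)
  then show "(\<integral>\<^sup>+x. ennreal (indicator {0..} x *\<^sub>R exp (- h * x)) \<partial>lborel) < \<infinity>"
    using nn_integral_exp_minus[OF assms] by simp
qed auto

lemma set_integrable_sum:
  fixes f :: "'i \<Rightarrow> 'a \<Rightarrow> 'b::{banach, second_countable_topology}"
  shows "(\<And>i. i \<in> I \<Longrightarrow> set_integrable M A (f i)) \<Longrightarrow> set_integrable M A (\<lambda>x. \<Sum>i\<in>I. f i x)"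
  unfolding set_integrable_def by (simp add: scaleR_sum_right)

lemma set_integral_sum:
  fixes f :: "'i \<Rightarrow> 'a \<Rightarrow> 'b::{banach, second_countable_topology}"
  shows "(\<And>i. i \<in> I \<Longrightarrow> set_integrable M A (f i)) \<Longrightarrow>
    (LINT x:A|M. \<Sum>i\<in>I. f i x) = (\<Sum>i\<in>I. LINT x:A|M. f i x)"
  unfolding set_integrable_def set_lebesgue_integral_def by (simp add: scaleR_sum_right)

lemma nn_integral_set_integral:
  fixes f :: "real \<Rightarrow> real"
  assumes "set_integrable lborel {0..} f" "\<And>x. x \<ge> 0 \<Longrightarrow> f x \<ge> 0"
  shows "(\<integral>\<^sup>+x. ennreal (f x) * indicator {0..} x \<partial>lborel) = ennreal (LINT x:{0..}|lborel. f x)"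
proof -
  have "(\<integral>\<^sup>+x. ennreal (f x) * indicator {0..} x \<partial>lborel) = (\<integral>\<^sup>+x. ennreal (indicator {0..} x *\<^sub>R f x) \<partial>lborel)"
    by (intro nn_integral_cong) (auto split: split_indicator)
  also have "\<dots> = ennreal (LINT x:{0..}|lborel. f x)"
    using assms unfolding set_integrable_def set_lebesgue_integral_def
    by (intro nn_integral_eq_integral) (auto split: split_indicator)
  finally show ?thesis .
qed

text \<open>Integrating the derivative of the discounted row \<open>c\<close> over the half-line
  leaves the boundary value at zero; the bound kills the one at infinity. With \<open>R\<close> as a
  row vector the result reads \<open>R (h - A) = e_c\<close>. The bound concerns the single row
  \<open>c\<close>, which is what a chain visiting \<open>c\<close> can supply.\<close>

lemma resolvent_equation:
  fixes A :: "real^'n^'n" and h :: real and c :: 'n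
  defines "R \<equiv> \<lambda>d. LINT v:{0..}|lborel. exp (- h * v) * transition_semigroup A v $ c $ d"
  assumes h: "h > 0" and bound: "\<And>v d. v \<ge> 0 \<Longrightarrow> \<bar>transition_semigroup A v $ c $ d\<bar> \<le> 1"
  shows "set_integrable lborel {0..} (\<lambda>v. exp (- h * v) * transition_semigroup A v $ c $ b)"
    and "h * R b - (\<Sum>d\<in>UNIV. R d * A $ d $ b) = (if b = c then 1 else 0)"
proof -
  let ?P = "\<lambda>d v. transition_semigroup A v $ c $ d"
  have cont: "continuous_on S (?P d)" for d S
    by (rule DERIV_continuous_on, rule has_field_derivative_at_within, rule transition_semigroup_deriv)
  have int: "set_integrable lborel {0..} (\<lambda>v. exp (- h * v) * ?P d v)" for d
  proof (rule set_integrable_bound[OF set_integrable_exp_minus[OF h]])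
    show "set_borel_measurable lborel {0..} (\<lambda>v. exp (- h * v) * ?P d v)"
      unfolding set_borel_measurable_def
      by (intro borel_measurable_scaleR borel_measurable_times)
         (auto intro!: borel_measurable_continuous_onI cont continuous_intros)
    show "AE v in lborel. v \<in> {0..} \<longrightarrow> norm (exp (- h * v) * ?P d v) \<le> norm (exp (- h * v))"
      using bound by (simp add: abs_mult)
  qed
  show "set_integrable lborel {0..} (\<lambda>v. exp (- h * v) * ?P b v)"
    by (rule int)
  define f where "f v = (\<Sum>d\<in>UNIV. exp (- h * v) * ?P d v * A $ d $ b) - h * (exp (- h * v) * ?P b v)" for v
  have intf: "set_integrable lborel {0..} f"
    unfolding f_def
    by (intro set_integral_diff set_integrable_sum set_integrable_mult_left set_integrable_mult_right int)
  have lim: "((\<lambda>t. LINT v:{0..t}|lborel. f v) \<longlongrightarrow> (LINT v:{0..}|lborel. f v)) at_top"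
    by (intro tendsto_set_lebesgue_integral_at_top intf) auto
  have deriv: "((\<lambda>v. exp (- h * v) * ?P b v) has_real_derivative f v) (at v)" for v
    unfolding f_def
    by (rule derivative_eq_intros transition_semigroup_deriv refl)+
       (simp add: sum_distrib_left mult_ac algebra_simps)
  have "(LINT v:{0..t}|lborel. f v) = exp (- h * t) * ?P b t - ?P b 0" if "t \<ge> 0" for t
    unfolding set_lebesgue_integral_def
  proof (subst integral_FTC_atLeastAtMost[where F="\<lambda>v. exp (- h * v) * ?P b v"])
    show "((\<lambda>v. exp (- h * v) * ?P b v) has_vector_derivative f v) (at v within {0..t})" for v
      using deriv[of v] by (simp add: has_real_derivative_iff_has_vector_derivative has_vector_derivative_at_within)
    show "continuous_on {0..t} f"
      unfolding f_def by (intro continuous_intros cont)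
  qed (use that in auto)
  then have ev: "\<forall>\<^sub>F t in at_top. exp (- h * t) * ?P b t - ?P b 0 = (LINT v:{0..t}|lborel. f v)"
    by (intro eventually_mono[OF eventually_ge_at_top[of 0]]) simp
  have exp0: "((\<lambda>t. exp (- h * t)) \<longlongrightarrow> 0) at_top"
    using h by (intro filterlim_compose[OF exp_at_bot]
        filterlim_tendsto_neg_mult_at_bot[OF tendsto_const _ filterlim_ident]) auto
  have "((\<lambda>t. exp (- h * t) * ?P b t) \<longlongrightarrow> 0) at_top"
  proof (rule tendsto_0_le[OF exp0, of _ 1])
    show "\<forall>\<^sub>F t in at_top. norm (exp (- h * t) * ?P b t) \<le> norm (exp (- h * t)) * 1"
      using eventually_ge_at_top[of 0] by eventually_elim (use bound in \<open>simp add: abs_mult\<close>)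
  qed
  then have "((\<lambda>t. LINT v:{0..t}|lborel. f v) \<longlongrightarrow> 0 - ?P b 0) at_top"
    using ev by (intro Lim_transform_eventually[OF _ ev] tendsto_intros)
  then have "(LINT v:{0..}|lborel. f v) = - (if b = c then 1 else 0)"
    using tendsto_unique[OF _ lim] by (simp add: transition_semigroup_0 mat_def eq_commute)
  moreover have "(LINT v:{0..}|lborel. f v) = (\<Sum>d\<in>UNIV. R d * A $ d $ b) - h * R b"
  proof -
    have "set_integrable lborel {0..} (\<lambda>v. \<Sum>d\<in>UNIV. exp (- h * v) * ?P d v * A $ d $ b)"
      by (intro set_integrable_sum set_integrable_mult_left int)
    moreover have "set_integrable lborel {0..} (\<lambda>v. h * (exp (- h * v) * ?P b v))"
      by (intro set_integrable_mult_right int)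
    moreover have "(LINT v:{0..}|lborel. \<Sum>d\<in>UNIV. exp (- h * v) * ?P d v * A $ d $ b) =
        (\<Sum>d\<in>UNIV. R d * A $ d $ b)"
      unfolding R_def
      by (subst set_integral_sum) (intro set_integrable_mult_left int, rule sum.cong[OF refl], rule set_integral_mult_left)
    moreover have "(LINT v:{0..}|lborel. h * (exp (- h * v) * ?P b v)) = h * R b"
      unfolding R_def by (rule set_integral_mult_right)
    ultimately show ?thesis
      unfolding f_def by (simp only: set_integral_diff)
  qed
  ultimately show "h * R b - (\<Sum>d\<in>UNIV. R d * A $ d $ b) = (if b = c then 1 else 0)"
    by simp
qed

section \<open>Local times of right-continuous processes\<close>

lemma set_integral_singleton: "(LINT s:{x::real}|lborel. f s) = (0 :: real)"
  unfolding set_lebesgue_integral_def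
proof (rule integral_eq_zero_AE)
  show "AE s in lborel. indicator {x} s *\<^sub>R f s = 0"
    using AE_lborel_singleton[of x] by eventually_elim auto
qed

text \<open>Path regularity involves the sigma-algebra but no probability. The locale serves both
  \<open>M\<close> and the smaller sigma-algebra generated by the process, on which the independence
  of \<zeta> is stated.\<close>

locale right_continuous_process =
  fixes M :: "'w measure" and X :: "real \<Rightarrow> 'w \<Rightarrow> 'n::finite"
  assumes measurable_X: "t \<ge> 0 \<Longrightarrow> X t \<in> measurable M (count_space UNIV)"
    and right_continuous:
      "\<omega> \<in> space M \<Longrightarrow> t \<ge> 0 \<Longrightarrow> \<forall>\<^sub>F s in at_right t. X s \<omega> = X t \<omega>"
begin

text \<open>Because of \<open>Suc\<close>, the grid point lies strictly to the right of
  \<open>t\<close>, at distance at most \<open>\<delta> N\<close>, so it converges to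
  \<open>t\<close> from the right. In a discrete state space right-continuity then gives equality
  for all large \<open>N\<close>, not just closeness.\<close>

lemma eventually_grid_eq:
  fixes \<delta> :: "nat \<Rightarrow> real"
  assumes \<omega>: "\<omega> \<in> space M" and t: "t \<ge> 0" and pos: "\<And>N. \<delta> N > 0" and lim: "\<delta> \<longlonglongrightarrow> 0"
  shows "\<forall>\<^sub>F N in sequentially. X (real (Suc (nat \<lfloor>t / \<delta> N\<rfloor>)) * \<delta> N) \<omega> = X t \<omega>"
proof -
  let ?\<tau> = "\<lambda>N. real (Suc (nat \<lfloor>t / \<delta> N\<rfloor>)) * \<delta> N"
  have bounds: "t < ?\<tau> N" "?\<tau> N \<le> t + \<delta> N" for N
  proof -
    have "real (nat \<lfloor>t / \<delta> N\<rfloor>) = of_int \<lfloor>t / \<delta> N\<rfloor>"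
      using t pos[of N] by simp
    then show "t < ?\<tau> N" "?\<tau> N \<le> t + \<delta> N"
      using floor_divide_lower[OF pos[of N], of t] floor_divide_upper[OF pos[of N], of t]
      by (auto simp: algebra_simps)
  qed
  have "?\<tau> \<longlonglongrightarrow> t"
  proof (rule tendsto_sandwich[OF _ _ tendsto_const])
    show "(\<lambda>N. t + \<delta> N) \<longlonglongrightarrow> t"
      using tendsto_add[OF tendsto_const lim] by simp
  qed (use bounds in \<open>auto intro!: always_eventually less_imp_le simp del: of_nat_Suc\<close>)
  then have "filterlim ?\<tau> (at_right t) sequentially"
    using bounds by (intro tendsto_imp_filterlim_at_right) auto
  then show ?thesis
    using right_continuous[OF \<omega> t] by (auto simp: filterlim_iff)
qed

text \<open>Rounding time up to a grid leaves countably many fixed sampling times, and the rounded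
  paths eventually agree with the path. The map uses \<open>max 0 t\<close> because nothing is known
  of \<open>X\<close> at negative times.\<close>

lemma measurable_path [measurable]:
  "(\<lambda>(t, \<omega>). X (max 0 t) \<omega>) \<in> measurable (borel \<Otimes>\<^sub>M M) (count_space UNIV)"
proof (rule measurable_count_space_eq2[THEN iffD2], simp, intro conjI ballI)
  fix i
  define Y where "Y N z = X (real (Suc (nat \<lfloor>max 0 (fst z) / inverse (real (Suc N))\<rfloor>)) * inverse (real (Suc N))) (snd z)"
    for N and z :: "real \<times> 'w"
  have Y: "Y N \<in> measurable (borel \<Otimes>\<^sub>M M) (count_space UNIV)" for N
    unfolding Y_def
  proof (rule measurable_compose_countable[where f="\<lambda>k z. X (real (Suc k) * inverse (real (Suc N))) (snd z)"])
    show "(\<lambda>z. X (real (Suc k) * inverse (real (Suc N))) (snd z)) \<in> measurable (borel \<Otimes>\<^sub>M M) (count_space UNIV)" for k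
      by (rule measurable_compose[OF measurable_snd measurable_X]) simp
  qed measurable
  \<comment> \<open>Limits are taken of real-valued indicators, one state at a time; the event is
    recovered as the preimage of 1.\<close>
  have "(\<lambda>z. indicator {i} (X (max 0 (fst z)) (snd z)) :: real) \<in> borel_measurable (borel \<Otimes>\<^sub>M M)"
  proof (rule borel_measurable_LIMSEQ_real)
    show "(\<lambda>z. indicator {i} (Y N z) :: real) \<in> borel_measurable (borel \<Otimes>\<^sub>M M)" for N
      using Y[of N] by measurable
    fix z :: "real \<times> 'w" assume "z \<in> space (borel \<Otimes>\<^sub>M M)"
    then have "snd z \<in> space M"
      by (auto simp: space_pair_measure)
    then have "\<forall>\<^sub>F N in sequentially. Y N z = X (max 0 (fst z)) (snd z)"
      unfolding Y_def by (intro eventually_grid_eq LIMSEQ_inverse_real_of_nat) auto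
    then show "(\<lambda>N. indicator {i} (Y N z) :: real) \<longlonglongrightarrow> indicator {i} (X (max 0 (fst z)) (snd z))"
      by (intro tendsto_eventually) (auto elim: eventually_mono)
  qed
  then have "(\<lambda>z. indicator {i} (X (max 0 (fst z)) (snd z)) :: real) -` {1} \<inter> space (borel \<Otimes>\<^sub>M M) \<in> sets (borel \<Otimes>\<^sub>M M)"
    by (rule measurable_sets) simp
  also have "(\<lambda>z. indicator {i} (X (max 0 (fst z)) (snd z)) :: real) -` {1} = (\<lambda>(t, \<omega>). X (max 0 t) \<omega>) -` {i}"
    by (auto split: split_indicator_asm)
  finally show "(\<lambda>(t, \<omega>). X (max 0 t) \<omega>) -` {i} \<inter> space (borel \<Otimes>\<^sub>M M) \<in> sets (borel \<Otimes>\<^sub>M M)" .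
qed auto

lemma measurable_path_section:
  assumes "\<omega> \<in> space M"
  shows "(\<lambda>t. X (max 0 t) \<omega>) \<in> measurable borel (count_space UNIV)"
  using measurable_compose[OF measurable_Pair2' measurable_path, OF assms] by simp

lemma set_integrable_path:
  fixes f :: "'n \<Rightarrow> real"
  assumes "\<omega> \<in> space M"
  shows "set_integrable lborel {0..t} (\<lambda>s. f (X s \<omega>))"
proof -
  have "set_integrable lborel {0..t} (\<lambda>s. f (X (max 0 s) \<omega>))"
  proof (rule set_integrable_bound[where f="\<lambda>_. \<Sum>i\<in>UNIV. \<bar>f i\<bar>"])
    show "set_integrable lborel {0..t} (\<lambda>_. \<Sum>i\<in>UNIV. \<bar>f i\<bar>)"
      unfolding set_integrable_def by (intro integrable_scaleR_left integrable_real_indicator) (auto simp: emeasure_lborel_Icc_eq)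
    show "set_borel_measurable lborel {0..t} (\<lambda>s. f (X (max 0 s) \<omega>))"
      unfolding set_borel_measurable_def
      using measurable_path_section[OF assms] by measurable
    show "AE s in lborel. s \<in> {0..t} \<longrightarrow> norm (f (X (max 0 s) \<omega>)) \<le> norm (\<Sum>i\<in>UNIV. \<bar>f i\<bar>)"
      by (auto intro!: AE_I2 order_trans[OF member_le_sum[where f="\<lambda>i. \<bar>f i\<bar>"]])
  qed
  then show ?thesis
    unfolding set_integrable_def
    by (rule Bochner_Integration.integrable_cong[THEN iffD1, OF refl, rotated]) (auto split: split_indicator)
qed

text \<open>Measurability is needed jointly in time and outcome because the local time will be
  evaluated at the random time \<open>\<zeta> \<omega>\<close>.\<close>

lemma measurable_local_time:
  "(\<lambda>z. local_time X (fst z) (snd z)) \<in> borel_measurable (borel \<Otimes>\<^sub>M M)"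
proof -
  have eq: "local_time X t \<omega> = (\<chi> i. \<integral>s. (if 0 \<le> s \<and> s \<le> t then indicator {i} (X (max 0 s) \<omega>) else 0) \<partial>lborel)" for t \<omega>
    unfolding local_time_def set_lebesgue_integral_def vec_eq_iff
    by (auto intro!: Bochner_Integration.integral_cong split: split_indicator)
  have X: "(\<lambda>x. X (max 0 (snd x)) (snd (fst x))) \<in> measurable ((borel \<Otimes>\<^sub>M M) \<Otimes>\<^sub>M lborel) (count_space UNIV)"
    using measurable_compose[OF _ measurable_path, of "\<lambda>x. (snd x, snd (fst x))" "(borel \<Otimes>\<^sub>M M) \<Otimes>\<^sub>M lborel"]
    by simp
  have "(\<lambda>z. local_time X (fst z) (snd z) $ i) \<in> borel_measurable (borel \<Otimes>\<^sub>M M)" for i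
    unfolding eq vec_lambda_beta
    by (rule lborel.borel_measurable_lebesgue_integral) (use X in \<open>simp add: case_prod_beta; measurable\<close>)
  then show ?thesis
    by (subst borel_measurable_euclidean_space) (auto simp: Basis_vec_def inner_axis)
qed

text \<open>This is the occupation time formula: \<open>v\<close> becomes a potential integrated
  along the path.\<close>

lemma local_time_inner:
  assumes "\<omega> \<in> space M"
  shows "v \<bullet> local_time X t \<omega> = (LINT s:{0..t}|lborel. v $ X s \<omega>)"
proof -
  have "v \<bullet> local_time X t \<omega> = (\<Sum>i\<in>UNIV. LINT s:{0..t}|lborel. v $ i * indicator {i} (X s \<omega>))"
    by (simp add: inner_vec_def local_time_def)
  also have "\<dots> = (LINT s:{0..t}|lborel. \<Sum>i\<in>UNIV. v $ i * indicator {i} (X s \<omega>))"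
    using set_integrable_path[OF assms] by (subst set_integral_sum) auto
  also have "\<dots> = (LINT s:{0..t}|lborel. v $ X s \<omega>)"
    by (simp add: indicator_def of_bool_def sum.delta' if_distrib cong: if_cong)
  finally show ?thesis .
qed


text \<open>The sums see the path at finitely many times, which is all that finite-dimensional
  distributions control. Right endpoints fit right-continuity. Jumps may accumulate, so convergence
  comes from dominated convergence of the step functions \<open>f N\<close>.\<close>

lemma local_time_Riemann:
  assumes \<omega>: "\<omega> \<in> space M" and t: "t > 0"
  shows "(\<lambda>N. \<Sum>k<Suc N. t / Suc N * v $ X (real (Suc k) * (t / Suc N)) \<omega>) \<longlonglongrightarrow> v \<bullet> local_time X t \<omega>"
proof -
  define \<delta> where "\<delta> N = t / Suc N" for N
  have pos: "\<delta> N > 0" for N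
    using t by (simp add: \<delta>_def)
  have lim: "\<delta> \<longlonglongrightarrow> 0"
    unfolding \<delta>_def using tendsto_mult[OF tendsto_const[of t] LIMSEQ_inverse_real_of_nat]
    by (simp add: divide_inverse)
  let ?V = "\<Sum>i\<in>UNIV. \<bar>v $ i\<bar>"
  have V: "\<bar>v $ i\<bar> \<le> ?V" for i
    by (rule member_le_sum) auto
  define f where "f N r = indicator {0..<t} r *\<^sub>R v $ X (real (Suc (nat \<lfloor>r / \<delta> N\<rfloor>)) * \<delta> N) \<omega>" for N r
  define g where "g N k = v $ X (real (Suc k) * \<delta> N) \<omega>" for N k
  have f: "f N r = (\<Sum>k<Suc N. indicator {real k * \<delta> N..<real (Suc k) * \<delta> N} r *\<^sub>R g N k)" for N r
  proof (cases "r \<in> {0..<t}")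
    case True
    let ?k = "nat \<lfloor>r / \<delta> N\<rfloor>"
    have iff: "r \<in> {real k * \<delta> N..<real (Suc k) * \<delta> N} \<longleftrightarrow> k = ?k" for k
    proof -
      have "r \<in> {real k * \<delta> N..<real (Suc k) * \<delta> N} \<longleftrightarrow> of_int (int k) \<le> r / \<delta> N \<and> r / \<delta> N < of_int (int k) + 1"
        using pos[of N] by (simp add: field_simps)
      also have "\<dots> \<longleftrightarrow> \<lfloor>r / \<delta> N\<rfloor> = int k"
        by (simp only: floor_eq_iff)
      also have "\<dots> \<longleftrightarrow> k = ?k"
        using True pos[of N] by (auto simp: nat_eq_iff)
      finally show ?thesis .
    qed
    have "r / \<delta> N < real (Suc N)"
      using True t mult_strict_right_mono[of r t "real (Suc N)"] by (simp add: \<delta>_def field_simps)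
    then have "\<lfloor>r / \<delta> N\<rfloor> < int (Suc N)"
      by (simp add: floor_less_iff)
    then have "?k < Suc N"
      by linarith
    then have "f N r = (\<Sum>k<Suc N. if k = ?k then g N k else 0)"
      using True by (simp add: f_def g_def)
    also have "\<dots> = (\<Sum>k<Suc N. indicator {real k * \<delta> N..<real (Suc k) * \<delta> N} r *\<^sub>R g N k)"
      by (intro sum.cong refl) (auto simp only: indicator_def iff, auto)
    finally show ?thesis .
  next
    case False
    have "r \<notin> {real k * \<delta> N..<real (Suc k) * \<delta> N}" if "k < Suc N" for k
    proof
      assume r: "r \<in> {real k * \<delta> N..<real (Suc k) * \<delta> N}"
      have "real (Suc k) * \<delta> N \<le> real (Suc N) * \<delta> N" "0 \<le> real k * \<delta> N"
        using that pos[of N] by auto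
      then show False
        using r False by (simp add: \<delta>_def)
    qed
    then show ?thesis
      using False by (simp add: f_def)
  qed
  have int_f: "(\<integral>r. f N r \<partial>lborel) = (\<Sum>k<Suc N. t / Suc N * v $ X (real (Suc k) * (t / Suc N)) \<omega>)" for N
  proof -
    have "(\<integral>r. f N r \<partial>lborel) = (\<Sum>k<Suc N. \<integral>r. indicator {real k * \<delta> N..<real (Suc k) * \<delta> N} r *\<^sub>R g N k \<partial>lborel)"
      unfolding f using pos
      by (intro Bochner_Integration.integral_sum integrable_scaleR_left integrable_real_indicator)
         (auto simp: emeasure_lborel_Ico mult_right_mono less_imp_le)
    also have "\<dots> = (\<Sum>k<Suc N. \<delta> N * g N k)"
      using pos by (intro sum.cong refl) (simp add: algebra_simps less_imp_le)
    finally show ?thesis by (simp only: g_def \<delta>_def)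
  qed
  have "(\<lambda>N. \<integral>r. f N r \<partial>lborel) \<longlonglongrightarrow> (\<integral>r. indicator {0..<t} r *\<^sub>R v $ X (max 0 r) \<omega> \<partial>lborel)"
  proof (rule integral_dominated_convergence)
    show "(\<lambda>r. indicator {0..<t} r *\<^sub>R v $ X (max 0 r) \<omega>) \<in> borel_measurable lborel"
      using measurable_path_section[OF \<omega>] by measurable
    show "f N \<in> borel_measurable lborel" for N
      unfolding f[abs_def] by measurable
    show "integrable lborel (\<lambda>r. indicator {0..<t} r *\<^sub>R ?V)"
      using t by (intro integrable_scaleR_left integrable_real_indicator) auto
    show "AE r in lborel. norm (f N r) \<le> indicator {0..<t} r *\<^sub>R ?V" for N
      using V by (auto simp: f_def split: split_indicator)
    show "AE r in lborel. (\<lambda>N. f N r) \<longlonglongrightarrow> indicator {0..<t} r *\<^sub>R v $ X (max 0 r) \<omega>"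
    proof (rule AE_I2)
      fix r
      show "(\<lambda>N. f N r) \<longlonglongrightarrow> indicator {0..<t} r *\<^sub>R v $ X (max 0 r) \<omega>"
      proof (cases "r \<in> {0..<t}")
        case True
        then show ?thesis
          using eventually_grid_eq[OF \<omega> _ pos lim, of r]
          by (intro tendsto_eventually) (auto simp: f_def elim!: eventually_mono)
      qed (simp add: f_def)
    qed
  qed
  also have "(\<integral>r. indicator {0..<t} r *\<^sub>R v $ X (max 0 r) \<omega> \<partial>lborel) = (LINT r:{0..<t}|lborel. v $ X r \<omega>)"
    unfolding set_lebesgue_integral_def
    by (intro Bochner_Integration.integral_cong) (auto split: split_indicator)
  \<comment> \<open>The cells of the grid fill the half-open interval; the missing endpoint is a
    null set.\<close>
  also have "\<dots> = (LINT r:{0..t}|lborel. v $ X r \<omega>)"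
    by (rule set_integral_discrete_difference[of "{t}"]) auto
  finally show ?thesis
    unfolding int_f local_time_inner[OF \<omega>] .
qed

lemma local_time_inner_section [measurable]:
  "\<omega> \<in> space M \<Longrightarrow> (\<lambda>t. v \<bullet> local_time X t \<omega>) \<in> borel_measurable borel"
  using measurable_compose[OF measurable_Pair2' measurable_local_time] by simp

text \<open>The integrand \<open>v $ X s \<omega>\<close> need not be continuous, so the fundamental theorem of calculus is not
  available; instead the left-hand side has increments of quadratic order.\<close>

lemma exp_local_time_identity:
  assumes \<omega>: "\<omega> \<in> space M" and t: "t \<ge> 0" and v: "\<And>i. v $ i \<ge> 0"
  shows "set_integrable lborel {0..t} (\<lambda>s. v $ X s \<omega> * exp (- (v \<bullet> local_time X s \<omega>)))"
    and "exp (- (v \<bullet> local_time X t \<omega>)) +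
      (LINT s:{0..t}|lborel. v $ X s \<omega> * exp (- (v \<bullet> local_time X s \<omega>))) = 1"
proof -
  define I where "I s = v \<bullet> local_time X s \<omega>" for s
  define k where "k s = v $ X s \<omega> * exp (- I s)" for s
  define \<phi> where "\<phi> t = exp (- I t) + (LINT s:{0..t}|lborel. k s)" for t
  let ?V = "\<Sum>i\<in>UNIV. v $ i"
  have V: "v $ i \<le> ?V" for i
    by (rule member_le_sum) (auto simp: v)
  have int_v: "set_integrable lborel {0..t} (\<lambda>s. v $ X s \<omega>)" for t
    by (rule set_integrable_path[OF \<omega>])
  have I: "I t = (LINT s:{0..t}|lborel. v $ X s \<omega>)" for t
    unfolding I_def by (rule local_time_inner[OF \<omega>])
  have I0: "I s \<ge> 0" for s
    unfolding I set_lebesgue_integral_def using v by (intro Bochner_Integration.integral_nonneg) auto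
  have int_k: "set_integrable lborel {0..t} k" for t
  proof (rule set_integrable_bound[OF int_v])
    have "(\<lambda>s. indicator {0..t} s *\<^sub>R (v $ X (max 0 s) \<omega> * exp (- I s))) \<in> borel_measurable lborel"
      unfolding I_def using measurable_path_section[OF \<omega>] \<omega> by measurable
    also have "(\<lambda>s. indicator {0..t} s *\<^sub>R (v $ X (max 0 s) \<omega> * exp (- I s))) = (\<lambda>s. indicator {0..t} s *\<^sub>R k s)"
      by (auto simp: k_def fun_eq_iff split: split_indicator)
    finally show "set_borel_measurable lborel {0..t} k"
      unfolding set_borel_measurable_def .
    show "AE s in lborel. s \<in> {0..t} \<longrightarrow> norm (k s) \<le> norm (v $ X s \<omega>)"
      using I0 v by (auto simp: k_def abs_mult intro!: mult_left_le)
  qed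
  from int_k[of t]
  show "set_integrable lborel {0..t} (\<lambda>s. v $ X s \<omega> * exp (- (v \<bullet> local_time X s \<omega>)))"
    unfolding k_def[abs_def] I_def .
  \<comment> \<open>The drop of \<open>exp (- I)\<close> over the interval and the integral of
    \<open>k\<close> both lie between \<open>exp (- I t) * \<Delta>\<close> and
    \<open>exp (- I s) * \<Delta>\<close>. These bounds differ by at most the square of \<Delta>,
    and \<Delta> is at most linear in the length of the interval.\<close>
  have incr: "\<bar>\<phi> t - \<phi> s\<bar> \<le> (?V * (t - s))\<^sup>2" if st: "0 \<le> s" "s \<le> t" for s t
  proof -
    have split: "{0..t} = {0..s} \<union> {s<..t}"
      using st by auto
    have sub: "set_integrable lborel {s<..t} f" if "set_integrable lborel {0..t} f" for f :: "real \<Rightarrow> real"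
      using that by (rule set_integrable_subset) (use st in auto)
    have un: "(LINT r:{0..t}|lborel. f r) = (LINT r:{0..s}|lborel. f r) + (LINT r:{s<..t}|lborel. f r)"
      if "set_integrable lborel {0..t} f" for f :: "real \<Rightarrow> real"
      unfolding split using st that by (intro set_integral_Un set_integrable_subset[OF that]) auto
    define \<Delta> where "\<Delta> = (LINT r:{s<..t}|lborel. v $ X r \<omega>)"
    have It: "I t = I s + \<Delta>"
      unfolding I \<Delta>_def by (rule un[OF int_v])
    have const: "set_integrable lborel {s<..t} (\<lambda>_. c)" for c :: real
      unfolding set_integrable_def using st by (intro integrable_scaleR_left integrable_real_indicator) auto
    have "\<Delta> \<le> (LINT r:{s<..t}|lborel. ?V)"
      unfolding \<Delta>_def using V by (intro set_integral_mono sub int_v const) auto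
    also have "\<dots> = ?V * (t - s)"
      using st by (simp add: set_lebesgue_integral_def)
    finally have \<Delta>_le: "\<Delta> \<le> ?V * (t - s)" .
    have \<Delta>0: "\<Delta> \<ge> 0"
      unfolding \<Delta>_def set_lebesgue_integral_def using v by (intro Bochner_Integration.integral_nonneg) auto
    have Imono: "I r \<le> I r'" if "0 \<le> r" "r \<le> r'" for r r'
      unfolding I set_lebesgue_integral_def using that v int_v
      by (intro integral_mono) (auto simp: set_integrable_def split: split_indicator)
    have up: "(LINT r:{s<..t}|lborel. k r) \<le> exp (- I s) * \<Delta>"
      unfolding \<Delta>_def set_integral_mult_right[symmetric]
      using st v Imono by (intro set_integral_mono sub int_k set_integrable_mult_right int_v)
        (auto simp: k_def mult.commute intro!: mult_right_mono)
    have lo: "exp (- I t) * \<Delta> \<le> (LINT r:{s<..t}|lborel. k r)"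
      unfolding \<Delta>_def set_integral_mult_right[symmetric]
      using st v Imono by (intro set_integral_mono sub int_k set_integrable_mult_right int_v)
        (auto simp: k_def mult.commute intro!: mult_right_mono)
    have diff: "\<phi> t - \<phi> s = exp (- I t) - exp (- I s) + (LINT r:{s<..t}|lborel. k r)"
      unfolding \<phi>_def un[OF int_k] by simp
    have "exp (- I s) - exp (- I t) = exp (- I s) * (1 - exp (- \<Delta>))"
      by (simp add: It algebra_simps flip: exp_add)
    also have "\<dots> \<le> exp (- I s) * \<Delta>"
      using exp_ge_add_one_self[of "- \<Delta>"] by (intro mult_left_mono) auto
    finally have 1: "exp (- I s) - exp (- I t) \<le> exp (- I s) * \<Delta>" .
    have "exp (- I t) * \<Delta> \<le> exp (- I t) * (exp \<Delta> - 1)"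
      using exp_ge_add_one_self[of \<Delta>] by (intro mult_left_mono, linarith, simp)
    also have "\<dots> = exp (- I s) - exp (- I t)"
      by (simp add: It algebra_simps flip: exp_add)
    finally have 2: "exp (- I t) * \<Delta> \<le> exp (- I s) - exp (- I t)" .
    have "exp (- I s) * \<Delta> - exp (- I t) * \<Delta> = (exp (- I s) - exp (- I t)) * \<Delta>"
      by (simp add: algebra_simps)
    also have "\<dots> \<le> (exp (- I s) * \<Delta>) * \<Delta>"
      using 1 \<Delta>0 by (rule mult_right_mono)
    also have "\<dots> \<le> (1 * \<Delta>) * \<Delta>"
      using I0[of s] \<Delta>0 by (intro mult_right_mono) auto
    also have "\<dots> \<le> (?V * (t - s))\<^sup>2"
      using \<Delta>_le \<Delta>0 by (simp add: power2_eq_square mult_mono)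
    finally show ?thesis
      unfolding diff using 1 2 up lo by linarith
  qed
  \<comment> \<open>Quadratic increments force derivative zero at every point of the convex set
    \<open>{0..}\<close>, so \<phi> keeps its value at zero.\<close>
  have "(\<phi> has_field_derivative 0) (at x within {0..})" if x: "x \<in> {0..}" for x
    unfolding has_field_derivative_iff
  proof (rule tendsto_0_le[where K = "?V\<^sup>2"])
    show "((\<lambda>y. y - x) \<longlongrightarrow> 0) (at x within {0..})"
      by (intro LIM_zero tendsto_ident_at)
    have le: "\<bar>\<phi> y - \<phi> x\<bar> \<le> ?V\<^sup>2 * \<bar>y - x\<bar>\<^sup>2" if "y \<ge> 0" for y
      using incr[of x y] incr[of y x] x that
      by (cases "x \<le> y") (auto simp: power_mult_distrib abs_minus_commute power2_commute)
    show "\<forall>\<^sub>F y in at x within {0..}. norm ((\<phi> y - \<phi> x) / (y - x)) \<le> norm (y - x) * ?V\<^sup>2"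
    proof -
      have "norm ((\<phi> y - \<phi> x) / (y - x)) \<le> norm (y - x) * ?V\<^sup>2" if "y \<noteq> x" "y \<ge> 0" for y
        using le[OF that(2)] that by (simp add: pos_divide_le_eq power2_eq_square[of "\<bar>y - x\<bar>"] mult_ac del: power2_abs)
      then show ?thesis
        by (auto simp: eventually_at_filter)
    qed
  qed
  then obtain c where c: "\<And>x. x \<in> {0..} \<Longrightarrow> \<phi> x = c"
    using has_field_derivative_zero_constant[of "{0..}" \<phi>] by auto
  have "\<phi> 0 = 1"
    by (simp add: \<phi>_def I set_integral_singleton)
  then have "\<phi> t = 1"
    using c[of 0] c[of t] t by simp
  then show "exp (- (v \<bullet> local_time X t \<omega>)) +
      (LINT s:{0..t}|lborel. v $ X s \<omega> * exp (- (v \<bullet> local_time X s \<omega>))) = 1"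
    by (simp add: \<phi>_def k_def I_def)
qed

end

lemma local_time_nonneg: "local_time X t \<omega> \<in> orthant"
  by (auto simp: local_time_def orthant_def set_lebesgue_integral_def intro!: Bochner_Integration.integral_nonneg)

section \<open>The killed Green function\<close>

text \<open>Here \<open>v\<close> acts as a state-dependent killing rate and \<open>h\<close> as a
  uniform one. The matrix \<open>A\<close> stays general; facts about its semigroup are extracted
  from \<open>chain\<close>, and the transposed Laplacian is inserted only at the end.\<close>

locale killed_markov_chain =
  fixes M :: "'w measure" and X :: "real \<Rightarrow> 'w \<Rightarrow> 'n::finite" and A :: "real^'n^'n" and a :: 'n
    and v :: "real^'n" and h :: real
  assumes chain: "markov_chain M X A"
    and start: "AE \<omega> in M. X 0 \<omega> = a"
    and v_nonneg: "v $ i \<ge> 0"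
    and h_pos: "h > 0"

sublocale killed_markov_chain \<subseteq> prob_space M
  using chain by (simp add: markov_chain_def)

sublocale killed_markov_chain \<subseteq> right_continuous_process M X
  using chain by unfold_locales (auto simp: markov_chain_def)

lemma local_time_0: "local_time X 0 \<omega> = 0"
  by (simp add: local_time_def vec_eq_iff set_integral_singleton)

context killed_markov_chain
begin

abbreviation P :: "real \<Rightarrow> 'n \<Rightarrow> 'n \<Rightarrow> real" where
  "P t i j \<equiv> transition_semigroup A t $ i $ j"

abbreviation weight :: "real \<Rightarrow> 'w \<Rightarrow> real" where
  "weight t \<omega> \<equiv> exp (- (v \<bullet> local_time X t \<omega>))"

lemma local_time_measurable [measurable]: "local_time X t \<in> borel_measurable M"
  using measurable_compose[OF measurable_Pair1' measurable_local_time, of t] by simp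

lemma weight_le_1: "weight t \<omega> \<le> 1"
proof -
  have "0 \<le> v \<bullet> local_time X t \<omega>"
    using local_time_nonneg[of X t \<omega>] v_nonneg by (auto simp: inner_vec_def orthant_def intro!: sum_nonneg)
  then show ?thesis by simp
qed

section \<open>The Markov property for weighted expectations\<close>

lemma indicator_X_measurable:
  "t \<ge> 0 \<Longrightarrow> (\<lambda>\<omega>. indicator B (X t \<omega>) :: real) \<in> borel_measurable M"
  using measurable_X[of t] by measurable

text \<open>With finitely many states the expectation is a finite sum over histories. For each
  history the distribution formulas for \<open>k\<close> and for \<open>Suc k\<close> differ by
  exactly one transition factor.\<close>

lemma discrete_Markov_property:
  fixes t :: "nat \<Rightarrow> real" and F :: "(nat \<Rightarrow> 'n) \<Rightarrow> real"
  assumes t0: "0 \<le> t 0" and mono: "\<And>m. m \<le> k \<Longrightarrow> t m \<le> t (Suc m)"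
    and F: "\<And>x y. (\<And>m. m \<le> k \<Longrightarrow> x m = y m) \<Longrightarrow> F x = F y"
  shows "(\<integral>\<omega>. F (\<lambda>m. X (t m) \<omega>) * indicator {c} (X (t k) \<omega>) * indicator {b} (X (t (Suc k)) \<omega>) \<partial>M) =
    (\<integral>\<omega>. F (\<lambda>m. X (t m) \<omega>) * indicator {c} (X (t k) \<omega>) \<partial>M) * P (t (Suc k) - t k) c b"
proof -
  \<comment> \<open>Histories are extensional outside \<open>{..k}\<close>, so every outcome lies in
    \<open>E x\<close> for exactly one \<open>x\<close> in \<open>S\<close>, namely its restricted
    path.\<close>
  define S where "S = PiE {..k} (\<lambda>_. UNIV :: 'n set)"
  have fin: "finite S"
    unfolding S_def by (intro finite_PiE) auto
  define E where "E x = {\<omega> \<in> space M. \<forall>m\<le>k. X (t m) \<omega> = x m}" for x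
  have t_nonneg: "0 \<le> t m" if "m \<le> Suc k" for m
    using that
  proof (induction m)
    case (Suc m)
    then show ?case using mono[of m] by auto
  qed (rule t0)
  have E: "E x \<in> sets M" for x
  proof -
    have X: "X (t m) -` {x m} \<inter> space M \<in> sets M" if "m \<in> {..k}" for m
      using that by (intro measurable_sets[OF measurable_X] t_nonneg) auto
    have "E x = space M \<inter> (\<Inter>m\<in>{..k}. X (t m) -` {x m} \<inter> space M)"
      by (auto simp: E_def)
    also have "\<dots> \<in> sets M"
      by (intro sets.Int sets.top sets.finite_INT X) auto
    finally show ?thesis .
  qed
  have expand: "F (\<lambda>m. X (t m) \<omega>) * indicator {c} (X (t k) \<omega>) =
      (\<Sum>x\<in>S. F x * indicator {c} (x k) * indicator (E x) \<omega>)" if \<omega>: "\<omega> \<in> space M" for \<omega>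
  proof -
    let ?x = "restrict (\<lambda>m. X (t m) \<omega>) {..k}"
    have "(\<Sum>x\<in>S. F x * indicator {c} (x k) * indicator (E x) \<omega>) =
        (\<Sum>x\<in>S. if x = ?x then F x * indicator {c} (x k) else 0)"
    proof (intro sum.cong refl)
      fix x assume x: "x \<in> S"
      have "\<omega> \<in> E x \<longleftrightarrow> x = ?x"
        using x \<omega> by (auto simp: S_def E_def PiE_def extensional_def fun_eq_iff restrict_def)
      then show "F x * indicator {c} (x k) * indicator (E x) \<omega> = (if x = ?x then F x * indicator {c} (x k) else 0)"
        by (simp add: indicator_def)
    qed
    also have "\<dots> = F ?x * indicator {c} (X (t k) \<omega>)"
      using fin by (simp add: S_def)
    also have "F ?x = F (\<lambda>m. X (t m) \<omega>)"
      by (rule F) simp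
    finally show ?thesis by simp
  qed
  have meas: "(\<integral>\<omega>. indicator (E x) \<omega> * indicator {b} (X (t (Suc k)) \<omega>) \<partial>M) =
      measure M (E x) * P (t (Suc k) - t k) (x k) b" for x
  proof -
    let ?y = "x(Suc k := b)"
    have fdd: "measure M {\<omega> \<in> space M. \<forall>m\<le>k. X (t m) \<omega> = x m} =
        measure M {\<omega> \<in> space M. X (t 0) \<omega> = x 0} * (\<Prod>m<k. P (t (Suc m) - t m) (x m) (x (Suc m)))"
      if "\<And>m. m < k \<Longrightarrow> t m \<le> t (Suc m)" for k x
      using chain t0 that unfolding markov_chain_def by blast
    have "(\<integral>\<omega>. indicator (E x) \<omega> * indicator {b} (X (t (Suc k)) \<omega>) \<partial>M) =
        (\<integral>\<omega>. (indicator {\<omega> \<in> space M. \<forall>m\<le>Suc k. X (t m) \<omega> = ?y m} \<omega> :: real) \<partial>M)"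
      by (intro Bochner_Integration.integral_cong refl) (auto simp: E_def le_Suc_eq split: split_indicator)
    also have "\<dots> = measure M {\<omega> \<in> space M. \<forall>m\<le>Suc k. X (t m) \<omega> = ?y m}"
      by (simp add: Int_absorb2 subset_eq)
    also have "\<dots> = measure M (E x) * P (t (Suc k) - t k) (x k) b"
      unfolding E_def by (subst fdd, use mono in simp, subst fdd, use mono in simp) simp
    finally show ?thesis .
  qed
  have int: "integrable M (\<lambda>\<omega>. indicator (E x) \<omega> * indicator {b} (X (t (Suc k)) \<omega>) :: real)" for x
    using E[of x] indicator_X_measurable[OF t_nonneg[of "Suc k"]]
    by (intro integrable_const_bound[of _ 1]) (auto split: split_indicator)
  have int': "integrable M (\<lambda>\<omega>. indicator (E x) \<omega> :: real)" for x
    using E[of x] by (intro integrable_real_indicator) (auto simp: emeasure_eq_measure)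
  have "(\<integral>\<omega>. F (\<lambda>m. X (t m) \<omega>) * indicator {c} (X (t k) \<omega>) * indicator {b} (X (t (Suc k)) \<omega>) \<partial>M) =
      (\<integral>\<omega>. (\<Sum>x\<in>S. F x * indicator {c} (x k) * (indicator (E x) \<omega> * indicator {b} (X (t (Suc k)) \<omega>))) \<partial>M)"
    by (intro Bochner_Integration.integral_cong refl) (simp add: expand sum_distrib_left mult_ac)
  also have "\<dots> = (\<Sum>x\<in>S. F x * indicator {c} (x k) * (measure M (E x) * P (t (Suc k) - t k) (x k) b))"
    by (simp add: int meas)
  also have "\<dots> = (\<Sum>x\<in>S. F x * indicator {c} (x k) * measure M (E x)) * P (t (Suc k) - t k) c b"
    by (auto simp: sum_distrib_right indicator_def intro!: sum.cong)
  also have "(\<Sum>x\<in>S. F x * indicator {c} (x k) * measure M (E x)) =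
      (\<integral>\<omega>. (\<Sum>x\<in>S. F x * indicator {c} (x k) * indicator (E x) \<omega>) \<partial>M)"
    using E by (subst Bochner_Integration.integral_sum)
      (auto intro!: integrable_mult_right int' sum.cong simp: Int_absorb2 sets.sets_into_space)
  also have "\<dots> = (\<integral>\<omega>. F (\<lambda>m. X (t m) \<omega>) * indicator {c} (X (t k) \<omega>) \<partial>M)"
    by (intro Bochner_Integration.integral_cong refl) (simp add: expand)
  finally show ?thesis .
qed

text \<open>The weight depends on the whole path up to \<open>s\<close>, but its Riemann
  approximations depend on a grid, where the discrete version applies. All approximations are
  bounded by 1, so dominated convergence passes to the limit on both sides.\<close>

lemma Markov_property:
  assumes s: "s \<ge> 0" and w: "w \<ge> 0"
  shows "(\<integral>\<omega>. weight s \<omega> * indicator {c} (X s \<omega>) * indicator {b} (X (s + w) \<omega>) \<partial>M) =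
    (\<integral>\<omega>. weight s \<omega> * indicator {c} (X s \<omega>) \<partial>M) * P w c b"
\<comment> \<open>A grid of mesh \<open>s / Suc N\<close> needs \<open>s > 0\<close>. At
  \<open>s = 0\<close> the weight is 1 and two time points suffice.\<close>
proof (cases "s = 0")
  case True
  then show ?thesis
    using local_time_0[of X]  discrete_Markov_property[of "\<lambda>m. if m = 0 then 0 else w" 0 "\<lambda>_. 1" c b] w True by simp
next
  case False
  then have s: "s > 0" using s by simp
  \<comment> \<open>The grid reaches \<open>s\<close> at index \<open>Suc N\<close>, and the
    following index is the future time \<open>s + w\<close>. Since \<open>F N\<close> reads the
    indices 1 to \<open>Suc N\<close>, it is a function of the history up to
    \<open>s\<close>.\<close>
  define t where "t N m = (if m \<le> Suc N then real m * (s / Suc N) else s + w)" for N m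
  define F where "F N x = exp (- (\<Sum>k<Suc N. s / Suc N * v $ x (Suc k)))" for N and x :: "nat \<Rightarrow> 'n"
  define W where "W N \<omega> = F N (\<lambda>m. X (t N m) \<omega>)" for N \<omega>
  have t_eq: "t N (Suc N) = s" "t N (Suc (Suc N)) = s + w" for N
    by (auto simp: t_def)
  have W_lim: "(\<lambda>N. W N \<omega>) \<longlonglongrightarrow> weight s \<omega>" if "\<omega> \<in> space M" for \<omega>
  proof -
    have "W N \<omega> = exp (- (\<Sum>k<Suc N. s / Suc N * v $ X (real (Suc k) * (s / Suc N)) \<omega>))" for N
      unfolding W_def F_def t_def by (intro arg_cong[where f=exp] arg_cong[where f=uminus] sum.cong) auto
    then show ?thesis
      using local_time_Riemann[OF that s] by (auto intro!: tendsto_intros simp del: sum.lessThan_Suc)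
  qed
  have t_nonneg: "t N m \<ge> 0" for N m
    using s w by (simp add: t_def)
  have W_meas: "W N \<in> borel_measurable M" for N
    unfolding W_def[abs_def] F_def using measurable_X[OF t_nonneg] by measurable
  have W_bound: "\<bar>W N \<omega>\<bar> \<le> 1" for N \<omega>
    unfolding W_def F_def using v_nonneg s by (simp add: sum_nonneg del: sum.lessThan_Suc)
  have lim1: "(\<lambda>N. \<integral>\<omega>. W N \<omega> * indicator {c} (X s \<omega>) * indicator {b} (X (s + w) \<omega>) \<partial>M) \<longlonglongrightarrow>
      (\<integral>\<omega>. weight s \<omega> * indicator {c} (X s \<omega>) * indicator {b} (X (s + w) \<omega>) \<partial>M)"
    using s w W_meas indicator_X_measurable[of s] indicator_X_measurable[of "s + w"] W_lim W_bound
    by (intro integral_dominated_convergence[where w="\<lambda>_. 1"])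
       (auto intro!: tendsto_intros AE_I2 split: split_indicator)
  have lim2: "(\<lambda>N. (\<integral>\<omega>. W N \<omega> * indicator {c} (X s \<omega>) \<partial>M) * P w c b) \<longlonglongrightarrow>
      (\<integral>\<omega>. weight s \<omega> * indicator {c} (X s \<omega>) \<partial>M) * P w c b"
    using s W_meas indicator_X_measurable[of s] W_lim W_bound
    by (intro tendsto_mult tendsto_const integral_dominated_convergence[where w="\<lambda>_. 1"])
       (auto intro!: tendsto_intros AE_I2 split: split_indicator)
  have eq: "(\<integral>\<omega>. W N \<omega> * indicator {c} (X s \<omega>) * indicator {b} (X (s + w) \<omega>) \<partial>M) =
      (\<integral>\<omega>. W N \<omega> * indicator {c} (X s \<omega>) \<partial>M) * P w c b" for N
  proof -
    have mono: "t N m \<le> t N (Suc m)" if "m \<le> Suc N" for m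
      using that s w by (cases "m = Suc N") (auto simp: t_def field_simps)
    have "F N x = F N y" if "\<And>m. m \<le> Suc N \<Longrightarrow> x m = y m" for x y
      unfolding F_def using that by (intro arg_cong[where f=exp] arg_cong[where f=uminus] sum.cong) auto
    from discrete_Markov_property[of "t N" "Suc N" "F N" c b, OF t_nonneg mono this]
    show ?thesis
      by (simp only: t_eq W_def add_diff_cancel_left')
  qed
  show ?thesis
    using lim1 lim2 unfolding eq by (rule LIMSEQ_unique)
qed


text \<open>For \<open>s \<ge> 0\<close> this is the sub-probability law of the state at time
  \<open>s\<close> under the weight. Inserting \<open>max 0\<close> makes it a measurable function
  of all real \<open>s\<close>.\<close>

definition mass :: "'n \<Rightarrow> real \<Rightarrow> real" where
  "mass c s = (\<integral>\<omega>. weight s \<omega> * indicator {c} (X (max 0 s) \<omega>) \<partial>M)"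

definition green :: "'n \<Rightarrow> real" where
  "green c = (LINT s:{0..}|lborel. exp (- h * s) * mass c s)"

text \<open>The free counterpart of \<open>green\<close>, without the potential. For a state
  \<open>c\<close> that is never visited the integral is not known to exist.\<close>

definition resolvent :: "'n \<Rightarrow> 'n \<Rightarrow> real" where
  "resolvent c b = (LINT w:{0..}|lborel. exp (- h * w) * P w c b)"

lemma weight_joint_measurable [measurable]:
  "(\<lambda>z. weight (fst z) (snd z)) \<in> borel_measurable (borel \<Otimes>\<^sub>M M)"
  using measurable_local_time by measurable

lemma mass_measurable [measurable]: "mass c \<in> borel_measurable borel"
  unfolding mass_def[abs_def]
proof (rule borel_measurable_lebesgue_integral)
  show "(\<lambda>(s, \<omega>). weight s \<omega> * indicator {c} (X (max 0 s) \<omega>)) \<in> borel_measurable (borel \<Otimes>\<^sub>M M)"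
    using weight_joint_measurable measurable_path by (simp add: case_prod_beta) measurable
qed

lemma P_continuous: "continuous_on S (\<lambda>w. P w c b)"
  by (rule DERIV_continuous_on, rule has_field_derivative_at_within, rule transition_semigroup_deriv)

lemma P_measurable [measurable]: "(\<lambda>w. P w c b) \<in> borel_measurable borel"
  by (intro borel_measurable_continuous_onI P_continuous)

lemma integrable_weight_X:
  assumes "s \<ge> 0"
  shows "integrable M (\<lambda>\<omega>. weight s \<omega> * indicator {c} (X s \<omega>))"
  using indicator_X_measurable[OF assms] weight_le_1
  by (intro integrable_const_bound[of _ 1]) (auto split: split_indicator)

lemma integrable_weight_X_X:
  assumes "s \<ge> 0" "t \<ge> 0"
  shows "integrable M (\<lambda>\<omega>. weight s \<omega> * indicator {c} (X s \<omega>) * indicator {b} (X t \<omega>))"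
  using indicator_X_measurable[OF assms(1)] indicator_X_measurable[OF assms(2)] weight_le_1
  by (intro integrable_const_bound[of _ 1]) (auto split: split_indicator)

lemma mass_eq: "s \<ge> 0 \<Longrightarrow> mass c s = (\<integral>\<omega>. weight s \<omega> * indicator {c} (X s \<omega>) \<partial>M)"
  by (simp add: mass_def)

lemma mass_nonneg: "mass c s \<ge> 0"
  by (auto simp: mass_def intro!: Bochner_Integration.integral_nonneg)

lemma mass_le_1: "s \<ge> 0 \<Longrightarrow> mass c s \<le> 1"
  using integral_mono[OF integrable_weight_X[of s c], of "\<lambda>_. 1"] weight_le_1
  by (auto simp: mass_eq prob_space split: split_indicator)

text \<open>By the Markov property the product is the expectation of a nonnegative variable. In this
  way the sign of a semigroup entry is found without looking at the series that defines it.\<close>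

lemma mass_times_P_nonneg:
  assumes "s \<ge> 0" "w \<ge> 0"
  shows "mass c s * P w c b \<ge> 0"
  unfolding mass_eq[OF assms(1)] Markov_property[OF assms, symmetric]
  by (intro Bochner_Integration.integral_nonneg) auto

lemma mass_times_P_le:
  assumes "s \<ge> 0" "w \<ge> 0"
  shows "mass c s * P w c b \<le> mass c s"
  unfolding mass_eq[OF assms(1)] Markov_property[OF assms, symmetric]
  using assms by (intro integral_mono integrable_weight_X_X integrable_weight_X) (auto split: split_indicator)

text \<open>Stochasticity of the semigroup is read off from the process itself, hence is available only for
  rows of states that the process visits; the rows of the other states always carry the factor zero.\<close>

lemma P_bounds:
  assumes "s \<ge> 0" "mass c s \<noteq> 0" "w \<ge> 0"
  shows "0 \<le> P w c b" "P w c b \<le> 1"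
  using mass_times_P_nonneg[OF assms(1,3), of c b] mass_times_P_le[OF assms(1,3), of c b] mass_nonneg[of c s] assms(2)
  by (auto simp: zero_le_mult_iff)

lemma mass_0: "mass c 0 = (if c = a then 1 else 0)"
proof -
  have "mass c 0 = (\<integral>\<omega>. indicator {c} (X 0 \<omega>) \<partial>M)"
    by (simp add: mass_eq local_time_0)
  also have "\<dots> = (\<integral>\<omega>. indicator {c} a \<partial>M)"
    using start indicator_X_measurable[of 0] by (intro integral_cong_AE) auto
  finally show ?thesis
    by (simp add: prob_space)
qed

lemma green_integrable: "set_integrable lborel {0..} (\<lambda>s. exp (- h * s) * mass c s)"
proof (rule set_integrable_bound[OF set_integrable_exp_minus[OF h_pos]])
  show "set_borel_measurable lborel {0..} (\<lambda>s. exp (- h * s) * mass c s)"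
    unfolding set_borel_measurable_def by measurable
qed (auto simp: abs_mult mass_nonneg mass_le_1)

lemma green_nonneg: "green c \<ge> 0"
  unfolding green_def set_lebesgue_integral_def
  by (intro Bochner_Integration.integral_nonneg) (auto simp: mass_nonneg)

lemma green_eq_0: "(\<And>s. s \<ge> 0 \<Longrightarrow> mass c s = 0) \<Longrightarrow> green c = 0"
  unfolding green_def set_lebesgue_integral_def
  by (intro integral_eq_zero_AE AE_I2) (auto split: split_indicator)

lemma resolvent_eq:
  assumes "s \<ge> 0" "mass c s \<noteq> 0"
  shows "set_integrable lborel {0..} (\<lambda>w. exp (- h * w) * P w c b)"
    and "h * resolvent c b - (\<Sum>d\<in>UNIV. resolvent c d * A $ d $ b) = (if b = c then 1 else 0)"
proof -
  have "\<bar>P w c d\<bar> \<le> 1" if "w \<ge> 0" for w d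
    using P_bounds[OF assms that, of d] by simp
  from resolvent_equation[OF h_pos this]
  show "set_integrable lborel {0..} (\<lambda>w. exp (- h * w) * P w c b)"
    and "h * resolvent c b - (\<Sum>d\<in>UNIV. resolvent c d * A $ d $ b) = (if b = c then 1 else 0)"
    unfolding resolvent_def by blast+
qed

text \<open>The pathwise identity is restricted to the event that \<open>X t = b\<close> and
  averaged; under the time integral, the Markov property at \<open>s\<close> splits off the free
  evolution from \<open>s\<close> to \<open>t\<close>. Working in \<open>ennreal\<close> makes the
  exchange of integrals a matter of measurability alone.\<close>

lemma Duhamel:
  assumes t: "t \<ge> 0"
  shows "ennreal (P t a b) =
    ennreal (mass b t) + (\<integral>\<^sup>+s. (\<Sum>c\<in>UNIV. ennreal (v $ c * (mass c s * P (t - s) c b))) * indicator {0..t} s \<partial>lborel)"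
proof -
  let ?k = "\<lambda>s \<omega>. v $ X (max 0 s) \<omega> * weight s \<omega> * indicator {b} (X t \<omega>)"
  have k_meas: "(\<lambda>(s, \<omega>). ?k s \<omega>) \<in> borel_measurable (borel \<Otimes>\<^sub>M M)"
    using measurable_path weight_joint_measurable measurable_compose[OF measurable_snd measurable_X[OF t], of borel]
    by (simp add: case_prod_beta) measurable

  interpret pair_sigma_finite lborel M ..
  have b_meas [measurable]: "(\<lambda>\<omega>. indicator {b} (X t \<omega>) :: real) \<in> borel_measurable M"
    by (rule indicator_X_measurable[OF t])
  have k_meas' [measurable]: "(\<lambda>(s, \<omega>). ennreal (?k s \<omega>) * indicator {0..t} s) \<in> borel_measurable (lborel \<Otimes>\<^sub>M M)"
    using k_meas by (simp add: case_prod_beta) measurable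
  \<comment> \<open>The Markov property at time zero and the almost sure start in \<open>a\<close>
    identify row \<open>a\<close> of the semigroup with the law of \<open>X t\<close>.\<close>
  have "P t a b = (\<integral>\<omega>. weight 0 \<omega> * indicator {a} (X 0 \<omega>) * indicator {b} (X (0 + t) \<omega>) \<partial>M)"
    using Markov_property[OF order_refl t, of a b] mass_0[of a] by (simp add: mass_eq)
  also have "\<dots> = (\<integral>\<omega>. indicator {b} (X t \<omega>) \<partial>M)"
    using start indicator_X_measurable[of 0] t by (intro integral_cong_AE) (auto simp: local_time_0)
  finally have "ennreal (P t a b) = ennreal (\<integral>\<omega>. indicator {b} (X t \<omega>) \<partial>M)"
    by simp
  also have "\<dots> = (\<integral>\<^sup>+\<omega>. ennreal (indicator {b} (X t \<omega>)) \<partial>M)"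
    by (intro nn_integral_eq_integral[symmetric] integrable_const_bound[of _ 1] b_meas) auto
  also have "\<dots> = (\<integral>\<^sup>+\<omega>. ennreal (weight t \<omega> * indicator {b} (X t \<omega>)) +
      (\<integral>\<^sup>+s. ennreal (?k s \<omega>) * indicator {0..t} s \<partial>lborel) \<partial>M)"
  proof (rule nn_integral_cong)
    fix \<omega> assume \<omega>: "\<omega> \<in> space M"
    note id = exp_local_time_identity[OF \<omega> t v_nonneg]
    have "(\<integral>\<^sup>+s. ennreal (v $ X (max 0 s) \<omega> * weight s \<omega>) * indicator {0..t} s \<partial>lborel) =
        (\<integral>\<^sup>+s. ennreal (indicator {0..t} s *\<^sub>R (v $ X s \<omega> * weight s \<omega>)) \<partial>lborel)"
      by (intro nn_integral_cong) (auto split: split_indicator)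
    also have "\<dots> = ennreal (LINT s:{0..t}|lborel. v $ X s \<omega> * weight s \<omega>)"
      using id(1) v_nonneg unfolding set_integrable_def set_lebesgue_integral_def
      by (intro nn_integral_eq_integral) auto
    finally have "ennreal (weight t \<omega>) + (\<integral>\<^sup>+s. ennreal (v $ X (max 0 s) \<omega> * weight s \<omega>) * indicator {0..t} s \<partial>lborel) = 1"
      using id(2) v_nonneg
      by (simp add: set_lebesgue_integral_def flip: ennreal_plus)
    then show "ennreal (indicator {b} (X t \<omega>)) = ennreal (weight t \<omega> * indicator {b} (X t \<omega>)) +
      (\<integral>\<^sup>+s. ennreal (?k s \<omega>) * indicator {0..t} s \<partial>lborel)"
      by (cases "X t \<omega> = b") auto
  qed
  also have "\<dots> = (\<integral>\<^sup>+\<omega>. ennreal (weight t \<omega> * indicator {b} (X t \<omega>)) \<partial>M) +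
      (\<integral>\<^sup>+\<omega>. (\<integral>\<^sup>+s. ennreal (?k s \<omega>) * indicator {0..t} s \<partial>lborel) \<partial>M)"
  proof (rule nn_integral_add)
    show "(\<lambda>\<omega>. \<integral>\<^sup>+s. ennreal (?k s \<omega>) * indicator {0..t} s \<partial>lborel) \<in> borel_measurable M"
      using measurable_compose[OF measurable_pair_swap' k_meas']
      by (intro lborel.borel_measurable_nn_integral) (simp add: case_prod_beta)
  qed measurable
  also have "(\<integral>\<^sup>+\<omega>. ennreal (weight t \<omega> * indicator {b} (X t \<omega>)) \<partial>M) = ennreal (mass b t)"
    unfolding mass_eq[OF t] by (intro nn_integral_eq_integral integrable_weight_X t) auto
  also have "(\<integral>\<^sup>+\<omega>. (\<integral>\<^sup>+s. ennreal (?k s \<omega>) * indicator {0..t} s \<partial>lborel) \<partial>M) =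
      (\<integral>\<^sup>+s. (\<integral>\<^sup>+\<omega>. ennreal (?k s \<omega>) * indicator {0..t} s \<partial>M) \<partial>lborel)"
    using Fubini[OF k_meas'] by simp
  also have "\<dots> = (\<integral>\<^sup>+s. (\<Sum>c\<in>UNIV. ennreal (v $ c * (mass c s * P (t - s) c b))) * indicator {0..t} s \<partial>lborel)"
  proof (rule nn_integral_cong)
    fix s
    show "(\<integral>\<^sup>+\<omega>. ennreal (?k s \<omega>) * indicator {0..t} s \<partial>M) =
        (\<Sum>c\<in>UNIV. ennreal (v $ c * (mass c s * P (t - s) c b))) * indicator {0..t} s"
    proof (cases "s \<in> {0..t}")
      case True
      let ?j = "\<lambda>c \<omega>. weight s \<omega> * indicator {c} (X s \<omega>) * indicator {b} (X t \<omega>)"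
      have int: "integrable M (?j c)" for c
        using True t by (intro integrable_weight_X_X) auto
      have "ennreal (?k s \<omega>) = (\<Sum>c\<in>UNIV. ennreal (v $ c * ?j c \<omega>))" for \<omega>
      proof -
        have "?k s \<omega> = (\<Sum>c\<in>UNIV. if c = X s \<omega> then v $ c * weight s \<omega> * indicator {b} (X t \<omega>) else 0)"
          using True by simp
        also have "\<dots> = (\<Sum>c\<in>UNIV. v $ c * ?j c \<omega>)"
          by (intro sum.cong) (auto simp: indicator_def)
        finally show ?thesis
          using v_nonneg by (simp add: sum_ennreal)
      qed
      then have "(\<integral>\<^sup>+\<omega>. ennreal (?k s \<omega>) * indicator {0..t} s \<partial>M) = (\<integral>\<^sup>+\<omega>. (\<Sum>c\<in>UNIV. ennreal (v $ c * ?j c \<omega>)) \<partial>M)"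
        using True by simp
      also have "\<dots> = (\<Sum>c\<in>UNIV. \<integral>\<^sup>+\<omega>. ennreal (v $ c * ?j c \<omega>) \<partial>M)"
        using int by (intro nn_integral_sum measurable_compose[OF _ measurable_ennreal]
            borel_measurable_integrable integrable_mult_right)
      also have "\<dots> = (\<Sum>c\<in>UNIV. ennreal (v $ c * (mass c s * P (t - s) c b)))"
      proof (intro sum.cong refl)
        fix c
        have "(\<integral>\<^sup>+\<omega>. ennreal (v $ c * ?j c \<omega>) \<partial>M) = ennreal (\<integral>\<omega>. v $ c * ?j c \<omega> \<partial>M)"
          using v_nonneg by (intro nn_integral_eq_integral integrable_mult_right int) auto
        also have "(\<integral>\<omega>. v $ c * ?j c \<omega> \<partial>M) = v $ c * (mass c s * P (t - s) c b)"
          using Markov_property[of s "t - s" c b] True by (simp add: mass_eq mult.assoc)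
        finally show "(\<integral>\<^sup>+\<omega>. ennreal (v $ c * ?j c \<omega>) \<partial>M) = ennreal (v $ c * (mass c s * P (t - s) c b))" .
      qed
      finally show ?thesis using True by simp
    qed simp
  qed
  finally show ?thesis .
qed

text \<open>The Laplace transform turns the time convolution in \<open>Duhamel\<close> into a
  product. The outcome is row \<open>a\<close> of the perturbation identity for resolvents.\<close>

lemma resolvent_Duhamel:
  "resolvent a b = green b + (\<Sum>c\<in>UNIV. v $ c * green c * resolvent c b)"
proof -
  \<comment> \<open>Extension by zero off the triangle \<open>0 \<le> s \<le> t\<close> gives a
    kernel on the whole plane, for which the order of integration can be exchanged.\<close>
  define K where "K c z = (if 0 \<le> snd z \<and> snd z \<le> fst z then
    ennreal (exp (- h * fst z) * (v $ c * (mass c (snd z) * P (fst z - snd z) c b))) else 0)" for c z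
  have K_meas [measurable]: "K c \<in> borel_measurable (lborel \<Otimes>\<^sub>M lborel)" for c
    unfolding K_def[abs_def] using mass_measurable[of c] P_measurable[of c b] by measurable
  have gP_int: "set_integrable lborel {0..} (\<lambda>t. exp (- h * t) * P t a b)" and P_a: "t \<ge> 0 \<Longrightarrow> 0 \<le> P t a b" for t
    using resolvent_eq(1)[of 0 a] P_bounds(1)[of 0 a] by (auto simp: mass_0)
  have res_nonneg: "v $ c * green c * resolvent c b \<ge> 0"
    and K_int: "(\<integral>\<^sup>+t. (\<integral>\<^sup>+s. K c (t, s) \<partial>lborel) \<partial>lborel) = ennreal (v $ c * green c * resolvent c b)" for c
  \<comment> \<open>For a state without mass the value of \<open>resolvent c b\<close> is
    uncontrolled, but \<open>K c\<close> and \<open>green c\<close> vanish. Otherwise one time of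
    positive mass makes row \<open>c\<close> nonnegative and its Laplace transform
    convergent.\<close>
  proof (atomize (full), cases "\<forall>s\<ge>0. mass c s = 0")
    case True
    then have "K c z = 0" "green c = 0" for z
      by (auto simp: K_def intro!: green_eq_0)
    then show "v $ c * green c * resolvent c b \<ge> 0 \<and>
      (\<integral>\<^sup>+t. (\<integral>\<^sup>+s. K c (t, s) \<partial>lborel) \<partial>lborel) = ennreal (v $ c * green c * resolvent c b)"
      by simp
  next
    case False
    then obtain s0 where s0: "s0 \<ge> 0" "mass c s0 \<noteq> 0" by auto
    have P0: "0 \<le> P w c b" if "w \<ge> 0" for w
      using P_bounds(1)[OF s0 that] .
    have R0: "resolvent c b \<ge> 0"
      unfolding resolvent_def set_lebesgue_integral_def using P0
      by (intro Bochner_Integration.integral_nonneg) (auto split: split_indicator)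
    have "(\<integral>\<^sup>+t. (\<integral>\<^sup>+s. K c (t, s) \<partial>lborel) \<partial>lborel) = (\<integral>\<^sup>+s. (\<integral>\<^sup>+t. K c (t, s) \<partial>lborel) \<partial>lborel)"
      using lborel_pair.Fubini[OF K_meas] by simp
    also have "\<dots> = (\<integral>\<^sup>+s. ennreal (exp (- h * s) * mass c s) * indicator {0..} s * (ennreal (v $ c) * ennreal (resolvent c b)) \<partial>lborel)"
    proof (rule nn_integral_cong)
      fix s
      \<comment> \<open>Substituting \<open>t = s + w\<close> turns the triangle into a quadrant, on
        which the kernel factors into a function of \<open>s\<close> and one of
        \<open>w\<close>.\<close>
      have "(\<integral>\<^sup>+t. K c (t, s) \<partial>lborel) = (\<integral>\<^sup>+w. K c (s + w, s) \<partial>lborel)"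
        using nn_integral_real_affine[of "\<lambda>t. K c (t, s)" 1 s] measurable_Pair2[OF K_meas] by simp
      also have "\<dots> = (\<integral>\<^sup>+w. ennreal (exp (- h * s) * mass c s) * indicator {0..} s * ennreal (v $ c) *
          (ennreal (exp (- h * w) * P w c b) * indicator {0..} w) \<partial>lborel)"
      proof (rule nn_integral_cong)
        fix w
        have e: "exp (- h * (s + w)) = exp (- h * s) * exp (- h * w)"
          by (simp add: distrib_left flip: exp_add)
        have "exp (- h * (s + w)) * (v $ c * (mass c s * P w c b)) = (exp (- h * s) * mass c s) * v $ c * (exp (- h * w) * P w c b)"
          unfolding e by (simp only: mult_ac)
        then show "K c (s + w, s) = ennreal (exp (- h * s) * mass c s) * indicator {0..} s * ennreal (v $ c) *
          (ennreal (exp (- h * w) * P w c b) * indicator {0..} w)"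
          using v_nonneg[of c] mass_nonneg[of c s] P0[of w]
          by (auto simp: K_def simp flip: ennreal_mult split: split_indicator)
      qed
      also have "\<dots> = ennreal (exp (- h * s) * mass c s) * indicator {0..} s * ennreal (v $ c) * ennreal (resolvent c b)"
        using nn_integral_set_integral[OF resolvent_eq(1)[OF s0], of b] P0
        by (subst nn_integral_cmult) (simp_all add: resolvent_def)
      finally show "(\<integral>\<^sup>+t. K c (t, s) \<partial>lborel) =
          ennreal (exp (- h * s) * mass c s) * indicator {0..} s * (ennreal (v $ c) * ennreal (resolvent c b))"
        by (simp add: mult.assoc)
    qed
    also have "\<dots> = ennreal (green c) * (ennreal (v $ c) * ennreal (resolvent c b))"
      using nn_integral_set_integral[OF green_integrable[of c]] mass_nonneg
      by (subst nn_integral_multc) (simp_all add: green_def)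
    also have "\<dots> = ennreal (v $ c * green c * resolvent c b)"
      using R0 v_nonneg green_nonneg by (simp add: mult_ac flip: ennreal_mult)
    finally show "v $ c * green c * resolvent c b \<ge> 0 \<and>
      (\<integral>\<^sup>+t. (\<integral>\<^sup>+s. K c (t, s) \<partial>lborel) \<partial>lborel) = ennreal (v $ c * green c * resolvent c b)"
      using R0 v_nonneg[of c] green_nonneg[of c] by simp
  qed
  have K_meas' [measurable]: "(\<lambda>t. \<integral>\<^sup>+s. K c (t, s) \<partial>lborel) \<in> borel_measurable lborel" for c
    by (rule lborel.borel_measurable_nn_integral_fst[OF K_meas])
  have "ennreal (resolvent a b) = (\<integral>\<^sup>+t. ennreal (exp (- h * t) * P t a b) * indicator {0..} t \<partial>lborel)"
    unfolding resolvent_def using gP_int P_a by (intro nn_integral_set_integral[symmetric]) auto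
  also have "\<dots> = (\<integral>\<^sup>+t. ennreal (exp (- h * t) * mass b t) * indicator {0..} t + (\<Sum>c\<in>UNIV. \<integral>\<^sup>+s. K c (t, s) \<partial>lborel) \<partial>lborel)"
  proof (rule nn_integral_cong)
    fix t :: real
    show "ennreal (exp (- h * t) * P t a b) * indicator {0..} t =
        ennreal (exp (- h * t) * mass b t) * indicator {0..} t + (\<Sum>c\<in>UNIV. \<integral>\<^sup>+s. K c (t, s) \<partial>lborel)"
    proof (cases "t \<ge> 0")
      case True
      define f where "f c s = ennreal (v $ c * (mass c s * P (t - s) c b)) * indicator {0..t} s" for c s
      have f_meas: "f c \<in> borel_measurable lborel" for c
        unfolding f_def[abs_def] by measurable
      have Ks: "K c (t, s) = ennreal (exp (- h * t)) * f c s" for c s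
        by (auto simp: K_def f_def ennreal_mult' split: split_indicator)
      have "(\<Sum>c\<in>UNIV. \<integral>\<^sup>+s. K c (t, s) \<partial>lborel) = ennreal (exp (- h * t)) * (\<Sum>c\<in>UNIV. \<integral>\<^sup>+s. f c s \<partial>lborel)"
        unfolding Ks sum_distrib_left by (intro sum.cong refl nn_integral_cmult f_meas)
      also have "(\<Sum>c\<in>UNIV. \<integral>\<^sup>+s. f c s \<partial>lborel) = (\<integral>\<^sup>+s. (\<Sum>c\<in>UNIV. f c s) \<partial>lborel)"
        by (rule nn_integral_sum[symmetric]) (rule f_meas)
      finally have "(\<Sum>c\<in>UNIV. \<integral>\<^sup>+s. K c (t, s) \<partial>lborel) =
          ennreal (exp (- h * t)) * (\<integral>\<^sup>+s. (\<Sum>c\<in>UNIV. ennreal (v $ c * (mass c s * P (t - s) c b))) * indicator {0..t} s \<partial>lborel)"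
        unfolding f_def sum_distrib_right .
      then show ?thesis
        using True Duhamel[OF True, of b] P_a[OF True] mass_nonneg[of b t]
        by (simp add: ennreal_mult distrib_left)
    next
      case False
      then have "K c (t, s) = 0" for c s
        by (auto simp: K_def)
      with False show ?thesis by simp
    qed
  qed
  also have "\<dots> = (\<integral>\<^sup>+t. ennreal (exp (- h * t) * mass b t) * indicator {0..} t \<partial>lborel) +
      (\<Sum>c\<in>UNIV. \<integral>\<^sup>+t. \<integral>\<^sup>+s. K c (t, s) \<partial>lborel \<partial>lborel)"
    by (subst nn_integral_add) (auto simp: nn_integral_sum)
  also have "(\<integral>\<^sup>+t. ennreal (exp (- h * t) * mass b t) * indicator {0..} t \<partial>lborel) = ennreal (green b)"
    unfolding green_def by (intro nn_integral_set_integral green_integrable) (simp add: mass_nonneg)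
  also have "ennreal (green b) + (\<Sum>c\<in>UNIV. \<integral>\<^sup>+t. \<integral>\<^sup>+s. K c (t, s) \<partial>lborel \<partial>lborel) =
      ennreal (green b + (\<Sum>c\<in>UNIV. v $ c * green c * resolvent c b))"
    unfolding K_int using res_nonneg green_nonneg by (simp add: sum_nonneg sum_ennreal)
  finally show ?thesis
    using res_nonneg green_nonneg P_a
    by (subst (asm) ennreal_inj) (auto intro!: add_nonneg_nonneg sum_nonneg Bochner_Integration.integral_nonneg
        simp: resolvent_def set_lebesgue_integral_def split: split_indicator)
qed

text \<open>Multiplying the perturbation identity by \<open>h - A\<close> from the right replaces
  each visited row of the resolvent by a unit vector. Rows of states without mass carry the factor
  \<open>green c = 0\<close>.\<close>

theorem green_equation:
  "h * green d - (\<Sum>b\<in>UNIV. green b * A $ b $ d) + v $ d * green d = (if d = a then 1 else 0)"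
proof -
  have a: "h * resolvent a d - (\<Sum>b\<in>UNIV. resolvent a b * A $ b $ d) = (if d = a then 1 else 0)"
    using resolvent_eq(2)[of 0 a] by (simp add: mass_0)
  have c: "v $ c * green c * (h * resolvent c d - (\<Sum>b\<in>UNIV. resolvent c b * A $ b $ d)) =
      (if c = d then v $ d * green d else 0)" for c
  proof (cases "\<forall>s\<ge>0. mass c s = 0")
    case True
    then have "green c = 0" by (intro green_eq_0) auto
    then show ?thesis by (cases "c = d") auto
  next
    case False
    then obtain s where "s \<ge> 0" "mass c s \<noteq> 0" by auto
    from resolvent_eq(2)[OF this, of d] show ?thesis by simp
  qed
  have "(if d = a then 1 else 0) = h * green d - (\<Sum>b\<in>UNIV. green b * A $ b $ d) +
      (\<Sum>c\<in>UNIV. v $ c * green c * (h * resolvent c d - (\<Sum>b\<in>UNIV. resolvent c b * A $ b $ d)))"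
    unfolding a[symmetric] resolvent_Duhamel
    by (simp add: algebra_simps sum.distrib sum_distrib_left sum_distrib_right sum_subtractf)
       (subst sum.swap, simp add: mult_ac)
  then show ?thesis
    unfolding c by simp
qed


text \<open>Independence allows averaging at a fixed time \<open>y\<close> before integrating over
  the law of \<zeta>. The density \<open>h * exp (- h * y)\<close> then turns the total mass at time
  \<open>y\<close> into \<open>h\<close> times the total Green function.\<close>

lemma expectation_weight_exponential_time:
  assumes \<zeta>: "distributed M lborel \<zeta> (exponential_density h)" and indep: "independent_of_process M X \<zeta>"
  shows "(\<integral>\<omega>. weight (\<zeta> \<omega>) \<omega> \<partial>M) = h * (\<Sum>b\<in>UNIV. green b)"
proof -
  \<comment> \<open>The local time is not a measurable functional on the space of all paths, so the joint law is taken
    over \<open>space M\<close> with the sigma-algebra generated by the process.\<close>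
  define path where "path \<omega> = (\<lambda>t\<in>{0..}. X t \<omega>)" for \<omega>
  define MX where "MX = vimage_algebra (space M) path (PiM {0..} (\<lambda>_. count_space UNIV))"
  define M\<zeta> where "M\<zeta> = vimage_algebra (space M) \<zeta> (borel :: real measure)"
  have ind: "indep_set (sets MX) (sets M\<zeta>)"
    using indep by (simp add: independent_of_process_def MX_def M\<zeta>_def path_def[abs_def])
  then have sub: "sets MX \<subseteq> sets M"
    unfolding indep_set_def indep_sets_def by (auto split: bool.splits)
  have space_MX: "space MX = space M"
    by (simp add: MX_def)
  have \<zeta>_meas [measurable]: "\<zeta> \<in> borel_measurable M"
    using distributed_measurable[OF \<zeta>] by simp
  have path_meas: "path \<in> measurable MX (PiM {0..} (\<lambda>_. count_space UNIV))"
    unfolding MX_def by (intro measurable_vimage_algebra1) (auto simp: path_def space_PiM)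
  \<comment> \<open>Right-continuity yields joint measurability of the local time already for the
    sigma-algebra of the process, where independence can be used.\<close>
  interpret MX: right_continuous_process MX X
  proof
    fix t :: real assume t: "t \<ge> 0"
    have "(\<lambda>\<omega>. path \<omega> t) \<in> measurable MX (count_space UNIV)"
      using t by (intro measurable_compose[OF path_meas measurable_component_singleton]) simp
    then show "X t \<in> measurable MX (count_space UNIV)"
      using t by (simp add: path_def)
  qed (auto simp: space_MX intro: right_continuous)
  have id_meas [measurable]: "id \<in> measurable M MX"
    using sub by (auto simp: measurable_def space_MX sets.sets_into_space Int_absorb2)
  have id_meas' [measurable]: "(\<lambda>\<omega>. \<omega>) \<in> measurable M MX"
    using id_meas by (simp add: id_def)
  interpret P1: prob_space "distr M MX id"
    by (rule prob_space_distr[OF id_meas])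
  interpret P2: prob_space "distr M borel \<zeta>"
    by (rule prob_space_distr[OF \<zeta>_meas])
  interpret P12: pair_sigma_finite "distr M MX id" "distr M borel \<zeta>" ..
  have W: "(\<lambda>z. ennreal (weight (snd z) (fst z))) \<in> borel_measurable (MX \<Otimes>\<^sub>M borel)"
    using measurable_compose[OF measurable_pair_swap' MX.measurable_local_time]
    by (simp add: case_prod_beta) measurable
  \<comment> \<open>Independence is expressed on rectangles: the outcome seen through
    \<open>MX\<close> and the value of \<zeta> have a product law.\<close>
  have joint: "distr M MX id \<Otimes>\<^sub>M distr M borel \<zeta> = distr M (MX \<Otimes>\<^sub>M borel) (\<lambda>\<omega>. (\<omega>, \<zeta> \<omega>))"
  proof (rule pair_measure_eqI)
    show "sets (distr M MX id \<Otimes>\<^sub>M distr M borel \<zeta>) = sets (distr M (MX \<Otimes>\<^sub>M borel) (\<lambda>\<omega>. (\<omega>, \<zeta> \<omega>)))"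
      by simp
    fix A B assume AB: "A \<in> sets (distr M MX id)" "B \<in> sets (distr M borel \<zeta>)"
    then have A: "A \<in> sets MX" and B: "\<zeta> -` B \<inter> space M \<in> sets M\<zeta>"
      by (auto simp: M\<zeta>_def intro: in_vimage_algebra)
    have A': "A \<subseteq> space M" "A \<in> sets M"
      using sub A sets.sets_into_space[OF A] by (auto simp: space_MX)
    have "emeasure (distr M (MX \<Otimes>\<^sub>M borel) (\<lambda>\<omega>. (\<omega>, \<zeta> \<omega>))) (A \<times> B) = emeasure M (A \<inter> (\<zeta> -` B \<inter> space M))"
      using A A' AB by (subst emeasure_distr) (auto intro!: arg_cong2[where f=emeasure] pair_measureI)
    also have "\<dots> = emeasure M A * emeasure M (\<zeta> -` B \<inter> space M)"
      using indep_setD[OF ind A B] by (simp add: emeasure_eq_measure ennreal_mult)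
    also have "\<dots> = emeasure (distr M MX id) A * emeasure (distr M borel \<zeta>) B"
      using A A' AB by (simp add: emeasure_distr Int_absorb2)
    finally show "emeasure (distr M MX id) A * emeasure (distr M borel \<zeta>) B =
        emeasure (distr M (MX \<Otimes>\<^sub>M borel) (\<lambda>\<omega>. (\<omega>, \<zeta> \<omega>))) (A \<times> B)" ..
  qed unfold_locales
  have "(\<integral>\<^sup>+\<omega>. ennreal (weight (\<zeta> \<omega>) \<omega>) \<partial>M) =
      (\<integral>\<^sup>+z. ennreal (weight (snd z) (fst z)) \<partial>(distr M (MX \<Otimes>\<^sub>M borel) (\<lambda>\<omega>. (\<omega>, \<zeta> \<omega>))))"
    using W by (subst nn_integral_distr) auto
  also have "\<dots> = (\<integral>\<^sup>+y. (\<integral>\<^sup>+\<omega>. ennreal (weight y \<omega>) \<partial>distr M MX id) \<partial>distr M borel \<zeta>)"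
    unfolding joint[symmetric] using W by (subst P12.nn_integral_snd[symmetric]) (auto simp: case_prod_beta')
  also have "\<dots> = (\<integral>\<^sup>+y. (\<integral>\<^sup>+\<omega>. ennreal (weight y \<omega>) \<partial>M) \<partial>distr M lborel \<zeta>)"
  proof -
    have "(\<lambda>\<omega>. ennreal (weight y \<omega>)) \<in> borel_measurable MX" for y
      using measurable_compose[OF measurable_Pair1'[of y borel] MX.measurable_local_time]
      by simp measurable
    then have "(\<integral>\<^sup>+\<omega>. ennreal (weight y \<omega>) \<partial>distr M MX id) = (\<integral>\<^sup>+\<omega>. ennreal (weight y \<omega>) \<partial>M)" for y
      by (subst nn_integral_distr) auto
    moreover have "distr M borel \<zeta> = distr M lborel \<zeta>"
      by (rule distr_cong) auto
    ultimately show ?thesis by simp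
  qed
  also have "\<dots> = (\<integral>\<^sup>+y. ennreal (exponential_density h y) * (\<integral>\<^sup>+\<omega>. ennreal (weight y \<omega>) \<partial>M) \<partial>lborel)"
  proof -
    have "(\<lambda>(y, \<omega>). ennreal (weight y \<omega>)) \<in> borel_measurable (lborel \<Otimes>\<^sub>M M)"
      using weight_joint_measurable by (simp add: case_prod_beta) measurable
    then have "(\<lambda>y. \<integral>\<^sup>+\<omega>. ennreal (weight y \<omega>) \<partial>M) \<in> borel_measurable lborel"
      by (rule borel_measurable_nn_integral)
    then show ?thesis
      unfolding distributed_distr_eq_density[OF \<zeta>]
      by (intro nn_integral_density distributed_borel_measurable[OF \<zeta>]) auto
  qed
  also have "\<dots> = (\<integral>\<^sup>+y. ennreal h * (\<Sum>b\<in>UNIV. ennreal (exp (- h * y) * mass b y) * indicator {0..} y) \<partial>lborel)"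
  proof (rule nn_integral_cong)
    fix y :: real
    show "ennreal (exponential_density h y) * (\<integral>\<^sup>+\<omega>. ennreal (weight y \<omega>) \<partial>M) =
        ennreal h * (\<Sum>b\<in>UNIV. ennreal (exp (- h * y) * mass b y) * indicator {0..} y)"
    proof (cases "y \<ge> 0")
      case True
      let ?j = "\<lambda>b \<omega>. weight y \<omega> * indicator {b} (X y \<omega>)"
      have "ennreal (weight y \<omega>) = (\<Sum>b\<in>UNIV. ennreal (?j b \<omega>))" for \<omega>
      proof -
        have "weight y \<omega> = (\<Sum>b\<in>UNIV. if b = X y \<omega> then weight y \<omega> else 0)"
          by simp
        also have "\<dots> = (\<Sum>b\<in>UNIV. ?j b \<omega>)"
          by (intro sum.cong) (auto simp: indicator_def)
        finally show ?thesis
          by (simp add: sum_ennreal)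
      qed
      then have "(\<integral>\<^sup>+\<omega>. ennreal (weight y \<omega>) \<partial>M) = (\<Sum>b\<in>UNIV. \<integral>\<^sup>+\<omega>. ennreal (?j b \<omega>) \<partial>M)"
        using True by (simp only:) (intro nn_integral_sum measurable_compose[OF _ measurable_ennreal]
            borel_measurable_integrable integrable_weight_X)
      also have "\<dots> = (\<Sum>b\<in>UNIV. ennreal (mass b y))"
        using True by (intro sum.cong refl) (auto simp: mass_eq intro!: nn_integral_eq_integral integrable_weight_X)
      finally show ?thesis
        using True h_pos mass_nonneg
        by (simp add: exponential_density_def ennreal_mult sum_distrib_left mult_ac del: sum_ennreal)
    qed (simp add: exponential_density_def)
  qed
  also have "\<dots> = ennreal h * (\<Sum>b\<in>UNIV. \<integral>\<^sup>+y. ennreal (exp (- h * y) * mass b y) * indicator {0..} y \<partial>lborel)"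
    by (rule trans[OF nn_integral_cmult], measurable, intro arg_cong2[where f="(*)"] refl nn_integral_sum, measurable)
  also have "\<dots> = ennreal h * (\<Sum>b\<in>UNIV. ennreal (green b))"
    unfolding green_def
    by (intro arg_cong2[where f="(*)"] refl sum.cong nn_integral_set_integral green_integrable) (simp add: mass_nonneg)
  also have "\<dots> = ennreal (h * (\<Sum>b\<in>UNIV. green b))"
    using h_pos green_nonneg by (simp add: sum_ennreal sum_nonneg flip: ennreal_mult)
  finally have eq: "(\<integral>\<^sup>+\<omega>. ennreal (weight (\<zeta> \<omega>) \<omega>) \<partial>M) = ennreal (h * (\<Sum>b\<in>UNIV. green b))" .
  have "(\<lambda>\<omega>. weight (\<zeta> \<omega>) \<omega>) \<in> borel_measurable M"
    using measurable_compose[OF _ weight_joint_measurable, of "\<lambda>\<omega>. (\<zeta> \<omega>, \<omega>)" M] by simp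
  then have "(\<integral>\<omega>. weight (\<zeta> \<omega>) \<omega> \<partial>M) = enn2real (\<integral>\<^sup>+\<omega>. ennreal (weight (\<zeta> \<omega>) \<omega>) \<partial>M)"
    by (intro integral_eq_nn_integral) auto
  then show ?thesis
    unfolding eq using h_pos green_nonneg by (simp add: sum_nonneg)
qed

end

section \<open>Gaussian integration by parts\<close>

lemma nn_integral_exp_minus_square_finite:
  assumes "(c::real) > 0"
  shows "(\<integral>\<^sup>+x. ennreal (exp (- c * x\<^sup>2)) \<partial>lborel) < \<infinity>"
proof -
  \<comment> \<open>The variance \<open>1 / (2 * c)\<close> makes the centred normal density
    proportional to \<open>exp (- c * x\<^sup>2)\<close>.\<close>
  define \<sigma> where "\<sigma> = 1 / sqrt (2 * c)"
  have \<sigma>: "\<sigma> > 0" "\<sigma>\<^sup>2 = 1 / (2 * c)"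
    using assms by (auto simp: \<sigma>_def power_divide)
  define k where "k = sqrt (2 * pi * \<sigma>\<^sup>2)"
  have eq: "exp (- c * x\<^sup>2) = k * normal_density 0 \<sigma> x" for x
    using assms \<sigma> unfolding normal_density_def k_def by (simp add: field_simps)
  have "(\<integral>\<^sup>+x. ennreal (normal_density 0 \<sigma> x) \<partial>lborel) = 1"
    using prob_space.emeasure_space_1[OF prob_space_normal_density[OF \<sigma>(1), of 0]]
    by (simp add: emeasure_density)
  then show ?thesis
    unfolding eq by (simp add: ennreal_mult'' nn_integral_cmult)
qed

lemma integrable_exp_minus_norm_square:
  assumes "(c::real) > 0"
  shows "integrable lborel (\<lambda>x::'a::euclidean_space. exp (- c * (norm x)\<^sup>2))"
proof (rule integrableI_nonneg)
  have norm_eq: "(norm x)\<^sup>2 = (\<Sum>b\<in>Basis. (x \<bullet> b)\<^sup>2)" for x :: 'a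
    unfolding power2_norm_eq_inner euclidean_inner[of x x] by (simp add: power2_eq_square)
  have eq: "exp (- c * (norm x)\<^sup>2) = (\<Prod>b\<in>Basis. exp (- c * (x \<bullet> b)\<^sup>2))" for x :: 'a
    by (simp add: norm_eq sum_distrib_left exp_sum flip: sum_negf)
  have "(\<integral>\<^sup>+x. ennreal (exp (- c * (norm x)\<^sup>2)) \<partial>(lborel :: 'a measure)) =
      (\<integral>\<^sup>+x. (\<Prod>b\<in>Basis. ennreal (exp (- c * (x \<bullet> b)\<^sup>2))) \<partial>(lborel :: 'a measure))"
    unfolding eq by (simp add: prod_ennreal)
  also have "\<dots> = (\<Prod>b\<in>(Basis :: 'a set). \<integral>\<^sup>+x. ennreal (exp (- c * x\<^sup>2)) \<partial>lborel)"
    by (rule nn_integral_lborel_prod) auto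
  also have "\<dots> < \<infinity>"
    using nn_integral_exp_minus_square_finite[OF assms] by (simp add: ennreal_prod_eq_top less_top power_less_top_ennreal)
  finally show "(\<integral>\<^sup>+x. ennreal (exp (- c * (norm x)\<^sup>2)) \<partial>(lborel :: 'a measure)) < \<infinity>" .
qed auto

text \<open>Half of the quadratic term absorbs the linear one by completing the square, so
  exponential growth factors are harmless.\<close>

lemma integrable_Gaussian_bound:
  fixes f :: "'a::euclidean_space \<Rightarrow> 'b::{banach, second_countable_topology}"
  assumes f: "f \<in> borel_measurable borel" and c: "c > 0"
    and bound: "\<And>x. norm (f x) \<le> exp (A + D * norm x - c * (norm x)\<^sup>2)"
  shows "integrable lborel f"
proof (rule Bochner_Integration.integrable_bound)
  show "integrable lborel (\<lambda>x::'a. exp (A + D\<^sup>2 / (2 * c)) * exp (- (c / 2) * (norm x)\<^sup>2))"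
    using c by (intro integrable_mult_right integrable_exp_minus_norm_square) auto
  show "f \<in> borel_measurable lborel" using f by simp
  have "norm (f x) \<le> exp (A + D\<^sup>2 / (2 * c)) * exp (- (c / 2) * (norm x)\<^sup>2)" for x
  proof -
    have "0 \<le> (D - c * norm x)\<^sup>2" by simp
    then have "2 * c * (D * norm x) \<le> D\<^sup>2 + c\<^sup>2 * (norm x)\<^sup>2"
      by (simp add: power2_diff power_mult_distrib algebra_simps)
    then have "D * norm x \<le> D\<^sup>2 / (2 * c) + c / 2 * (norm x)\<^sup>2"
      using c by (simp add: field_simps power2_eq_square)
    then have "A + D * norm x - c * (norm x)\<^sup>2 \<le> A + D\<^sup>2 / (2 * c) + - (c / 2) * (norm x)\<^sup>2"
      by simp
    then show ?thesis
      using order_trans[OF bound[of x]] by (metis exp_add exp_le_cancel_iff)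
  qed
  then show "AE x in lborel. norm (f x) \<le> norm (exp (A + D\<^sup>2 / (2 * c)) * exp (- (c / 2) * (norm x)\<^sup>2))"
    by simp
qed

text \<open>Differentiates the translation invariance of Lebesgue measure at zero.\<close>

lemma integral_deriv_exp_quadratic:
  fixes S l :: "'a::euclidean_space \<Rightarrow> complex"
  assumes shift: "\<And>x t. S (x + t *\<^sub>R e) = S x + of_real t * l x + of_real (t\<^sup>2) * \<kappa>"
    and S: "continuous_on UNIV S" and l: "continuous_on UNIV l"
    and c: "c > 0" and Re_S: "\<And>x. Re (S x) \<le> - c * (norm x)\<^sup>2"
    and l_bound: "\<And>x. cmod (l x) \<le> A + D * norm x"
  shows "integrable lborel (\<lambda>x. l x * exp (S x))" and "(\<integral>x. l x * exp (S x) \<partial>lborel) = 0"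
proof -
  have exp_bound: "y \<le> exp y" for y :: real
    using exp_ge_add_one_self[of y] by linarith
  have norm_exp: "norm (exp z - 1) \<le> norm z * exp (norm z)" for z :: complex
    using Taylor_exp_field[of z 0] by (simp add: mult.commute)
  have S_meas [measurable]: "S \<in> borel_measurable borel" and l_meas [measurable]: "l \<in> borel_measurable borel"
    using S l by (auto intro: borel_measurable_continuous_onI)
  have norm_S: "norm (exp (S x)) \<le> exp (- c * (norm x)\<^sup>2)" for x
    using Re_S[of x] by simp
  have int_S: "integrable lborel (\<lambda>x. exp (S x))"
    using norm_S by (intro integrable_Gaussian_bound[OF _ c, of _ 0 0]) auto
  show "integrable lborel (\<lambda>x. l x * exp (S x))"
  proof (rule integrable_Gaussian_bound[OF _ c])
    fix x
    have "norm (l x * exp (S x)) \<le> exp (A + D * norm x) * exp (- c * (norm x)\<^sup>2)"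
      unfolding norm_mult by (intro mult_mono norm_S order_trans[OF l_bound exp_bound]) auto
    then show "norm (l x * exp (S x)) \<le> exp (A + D * norm x - c * (norm x)\<^sup>2)"
      by (simp flip: exp_add)
  qed measurable
  define t where "t n = 1 / real (Suc n)" for n
  have t: "t n > 0" "t n \<le> 1" for n
    by (auto simp: t_def)
  have t_lim: "t \<longlonglongrightarrow> 0"
    unfolding t_def using LIMSEQ_inverse_real_of_nat by (simp add: inverse_eq_divide)
  define q where "q n x = (exp (S (x + t n *\<^sub>R e)) - exp (S x)) / of_real (t n)" for n x
  have q_eq: "q n x = exp (S x) * ((exp (of_real (t n) * l x + of_real ((t n)\<^sup>2) * \<kappa>) - 1) / of_real (t n))" for n x
    unfolding q_def shift by (simp add: exp_add algebra_simps)
  have shift_int: "integrable lborel (\<lambda>x. exp (S (x + t n *\<^sub>R e)))"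
    and shift_eq: "(\<integral>x. exp (S (x + t n *\<^sub>R e)) \<partial>lborel) = (\<integral>x. exp (S x) \<partial>lborel)" for n
    using int_S integrable_distr_eq[of "(+) (t n *\<^sub>R e)" lborel borel "\<lambda>x. exp (S x)"]
      integral_distr[of "(+) (t n *\<^sub>R e)" lborel borel "\<lambda>x. exp (S x)"]
    by (auto simp: lborel_distr_plus add.commute)
  have q_int: "(\<integral>x. q n x \<partial>lborel) = 0" for n
    unfolding q_def using int_S shift_int[of n] shift_eq[of n] by simp
  have "(\<lambda>n. \<integral>x. q n x \<partial>lborel) \<longlonglongrightarrow> (\<integral>x. l x * exp (S x) \<partial>lborel)"
  proof (rule integral_dominated_convergence)
    show "(\<lambda>x. l x * exp (S x)) \<in> borel_measurable lborel" by measurable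
    show "q n \<in> borel_measurable lborel" for n
      unfolding q_eq[abs_def] by measurable
    \<comment> \<open>With \<open>y = A + D * norm x + cmod \<kappa>\<close>, the difference
      quotient is at most \<open>y * exp y\<close> times the Gaussian factor, uniformly in
      \<open>n\<close> since \<open>t n \<le> 1\<close>. The bound \<open>y \<le> exp y\<close>
      gives \<open>exp (2 * y)\<close>, hence the factors 2.\<close>
    let ?w = "\<lambda>x. exp (2 * (A + cmod \<kappa>) + 2 * D * norm x - c * (norm x)\<^sup>2)"
    show "integrable lborel ?w"
      by (rule integrable_Gaussian_bound[OF _ c, of _ "2 * (A + cmod \<kappa>)" "2 * D"]) auto
    show "AE x in lborel. norm (q n x) \<le> ?w x" for n
    proof (rule AE_I2)
      fix x :: 'a
      define y where "y = A + D * norm x + cmod \<kappa>"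
      have y: "cmod (l x) + cmod \<kappa> \<le> y"
        using l_bound[of x] by (simp add: y_def)
      let ?z = "of_real (t n) * l x + of_real ((t n)\<^sup>2) * \<kappa>"
      have "norm ?z \<le> t n * cmod (l x) + (t n)\<^sup>2 * cmod \<kappa>"
        using t[of n] by (intro order_trans[OF norm_triangle_ineq]) (simp add: norm_mult norm_power)
      also have "\<dots> \<le> t n * cmod (l x) + t n * cmod \<kappa>"
        using t[of n] by (intro add_left_mono mult_right_mono) (auto simp: power2_eq_square mult_left_le)
      also have "\<dots> \<le> t n * y"
        using y t[of n] by (simp flip: distrib_left)
      finally have z: "norm ?z \<le> t n * y" .
      have y0: "0 \<le> y" using y by (smt (verit) norm_ge_zero)
      then have z': "norm ?z \<le> y"
        using z t[of n] by (smt (verit) mult_left_le_one_le)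
      have "norm (exp ?z - 1) \<le> norm ?z * exp (norm ?z)"
        by (rule norm_exp)
      also have "\<dots> \<le> (t n * y) * exp y"
        using z z' y0 t[of n] by (intro mult_mono) auto
      also have "\<dots> \<le> (t n * exp y) * exp y"
        using t[of n] exp_bound[of y] by (intro mult_right_mono mult_left_mono) auto
      finally have "norm ((exp ?z - 1) / of_real (t n)) \<le> exp y * exp y"
        using t[of n] by (simp add: norm_divide divide_le_eq mult_ac)
      then have "norm (q n x) \<le> exp (- c * (norm x)\<^sup>2) * (exp y * exp y)"
        unfolding q_eq norm_mult by (intro mult_mono norm_S) auto
      also have "\<dots> = ?w x"
        by (simp add: y_def algebra_simps flip: exp_add)
      finally show "norm (q n x) \<le> ?w x" .
    qed
    show "AE x in lborel. (\<lambda>n. q n x) \<longlonglongrightarrow> l x * exp (S x)"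
    proof (rule AE_I2)
      fix x :: 'a
      \<comment> \<open>The derivative is taken in a complex variable \<open>z\<close>; the real
        sequence \<open>t n\<close> is substituted afterwards.\<close>
      have "((\<lambda>z. exp (S x + z * l x + z\<^sup>2 * \<kappa>)) has_field_derivative l x * exp (S x)) (at 0)"
        by (auto intro!: derivative_eq_intros)
      then have "((\<lambda>z. (exp (S x + z * l x + z\<^sup>2 * \<kappa>) - exp (S x)) / z) \<longlongrightarrow> l x * exp (S x)) (at 0)"
        by (simp add: has_field_derivative_iff)
      moreover have "filterlim (\<lambda>n. complex_of_real (t n)) (at 0) sequentially"
        using t_lim t by (auto simp: filterlim_at intro!: always_eventually tendsto_eq_intros) (metis less_irrefl)+
      ultimately have "(\<lambda>n. (exp (S x + of_real (t n) * l x + (of_real (t n))\<^sup>2 * \<kappa>) - exp (S x)) / of_real (t n)) \<longlonglongrightarrow> l x * exp (S x)"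
        by (rule filterlim_compose)
      then show "(\<lambda>n. q n x) \<longlonglongrightarrow> l x * exp (S x)"
        by (simp add: q_def shift)
    qed
  qed
  then show "(\<integral>x. l x * exp (S x) \<partial>lborel) = 0"
    unfolding q_int by (metis LIMSEQ_unique tendsto_const)
qed

section \<open>Stationarity and the quadratic form of the Laplacian\<close>

lemma laplacian_entries:
  assumes "is_laplacian Q"
  obtains P p where "\<And>i j. Q $ i $ j = p $ i * (P $ i $ j - (if i = j then 1 else 0))"
    "\<And>i j. 0 \<le> P $ i $ j" "\<And>i. (\<Sum>j\<in>UNIV. P $ i $ j) = 1" "\<And>i. 0 \<le> p $ i"
    "\<And>j. (\<Sum>i\<in>UNIV. p $ i * P $ i $ j) = p $ j"
proof -
  obtain P p where *: "transition_matrix P" "stationary_distribution P p" "Q = diag_matrix p ** (P - mat 1)"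
    using assms by (auto simp: is_laplacian_def)
  show ?thesis
  proof (rule that)
    show "Q $ i $ j = p $ i * (P $ i $ j - (if i = j then 1 else 0))" for i j
      by (simp add: *(3) matrix_matrix_mult_def diag_matrix_def mat_def if_distrib[of "\<lambda>x. x * _"] cong: if_cong)
    have "(p v* P) $ j = p $ j" for j
      using *(2) by (simp add: stationary_distribution_def)
    then show "(\<Sum>i\<in>UNIV. p $ i * P $ i $ j) = p $ j" for j
      by (simp add: vector_matrix_mult_def mult.commute)
  qed (use * in \<open>auto simp: transition_matrix_def stationary_distribution_def\<close>)
qed

text \<open>This is stationarity of \<open>p\<close>. It produces the constant right-hand side of
  the moment equation.\<close>

lemma laplacian_column_sum:
  assumes "is_laplacian Q"
  shows "(\<Sum>i\<in>UNIV. Q $ i $ j) = 0"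
proof -
  obtain P p where *: "\<And>i j. Q $ i $ j = p $ i * (P $ i $ j - (if i = j then 1 else 0))"
    "\<And>j. (\<Sum>i\<in>UNIV. p $ i * P $ i $ j) = p $ j"
    by (rule laplacian_entries[OF assms]) blast
  have "(\<Sum>i\<in>UNIV. Q $ i $ j) = (\<Sum>i\<in>UNIV. p $ i * P $ i $ j) - (\<Sum>i\<in>UNIV. if i = j then p $ i else 0)"
    unfolding sum_subtractf[symmetric] by (intro sum.cong) (auto simp: * algebra_simps)
  then show ?thesis by (simp add: *)
qed

text \<open>Without symmetry the form is estimated directly: \<open>Re (x * cnj y)\<close> is at
  most the mean of the squared moduli. Row sums 1 evaluate the \<open>i\<close> half and
  stationarity the \<open>j\<close> half; together they equal the subtracted diagonal.\<close>

lemma laplacian_form_nonpos: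
  assumes "is_laplacian Q"
  shows "Re (\<Sum>i\<in>UNIV. \<Sum>j\<in>UNIV. \<phi> $ i * of_real (Q $ i $ j) * cnj (\<phi> $ j)) \<le> 0"
proof -
  obtain P p where *: "\<And>i j. Q $ i $ j = p $ i * (P $ i $ j - (if i = j then 1 else 0))"
    "\<And>i j. 0 \<le> P $ i $ j" "\<And>i. (\<Sum>j\<in>UNIV. P $ i $ j) = 1" "\<And>i. 0 \<le> p $ i"
    "\<And>j. (\<Sum>i\<in>UNIV. p $ i * P $ i $ j) = p $ j"
    by (rule laplacian_entries[OF assms]) blast
  let ?n = "\<lambda>i. (cmod (\<phi> $ i))\<^sup>2"
  have Re_le: "Re (x * cnj y) \<le> ((cmod x)\<^sup>2 + (cmod y)\<^sup>2) / 2" for x y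
    using complex_Re_le_cmod[of "x * cnj y"] sum_squares_bound[of "cmod x" "cmod y"]
    by (simp add: norm_mult)
  have "Re (\<Sum>i\<in>UNIV. \<Sum>j\<in>UNIV. \<phi> $ i * of_real (Q $ i $ j) * cnj (\<phi> $ j)) =
      (\<Sum>i\<in>UNIV. \<Sum>j\<in>UNIV. Q $ i $ j * Re (\<phi> $ i * cnj (\<phi> $ j)))"
    by (simp add: algebra_simps)
  also have "\<dots> = (\<Sum>i\<in>UNIV. \<Sum>j\<in>UNIV. p $ i * P $ i $ j * Re (\<phi> $ i * cnj (\<phi> $ j)) -
      (if i = j then p $ i * ?n i else 0))"
  proof (intro sum.cong refl)
    fix i j
    have sq: "Re (\<phi> $ i * cnj (\<phi> $ i)) = ?n i"
      by (simp add: cmod_power2 flip: power2_eq_square)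
    show "Q $ i $ j * Re (\<phi> $ i * cnj (\<phi> $ j)) =
        p $ i * P $ i $ j * Re (\<phi> $ i * cnj (\<phi> $ j)) - (if i = j then p $ i * ?n i else 0)"
    proof (cases "i = j")
      case True
      show ?thesis
        unfolding True[symmetric] * sq by (simp add: algebra_simps)
    qed (simp add: *)
  qed
  also have "\<dots> = (\<Sum>i\<in>UNIV. \<Sum>j\<in>UNIV. p $ i * P $ i $ j * Re (\<phi> $ i * cnj (\<phi> $ j))) - (\<Sum>i\<in>UNIV. p $ i * ?n i)"
    by (simp add: sum_subtractf)
  also have "(\<Sum>i\<in>UNIV. \<Sum>j\<in>UNIV. p $ i * P $ i $ j * Re (\<phi> $ i * cnj (\<phi> $ j))) \<le>
      (\<Sum>i\<in>UNIV. \<Sum>j\<in>UNIV. p $ i * P $ i $ j * ((?n i + ?n j) / 2))"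
    using * by (intro sum_mono mult_left_mono Re_le) auto
  also have "\<dots> = ((\<Sum>i\<in>UNIV. \<Sum>j\<in>UNIV. p $ i * ?n i * P $ i $ j) + (\<Sum>i\<in>UNIV. \<Sum>j\<in>UNIV. p $ i * P $ i $ j * ?n j)) / 2"
    unfolding sum.distrib[symmetric] sum_divide_distrib by (intro sum.cong refl) (simp add: algebra_simps)
  also have "(\<Sum>i\<in>UNIV. \<Sum>j\<in>UNIV. p $ i * ?n i * P $ i $ j) = (\<Sum>i\<in>UNIV. p $ i * ?n i)"
    by (simp add: * flip: sum_distrib_left)
  also have "(\<Sum>i\<in>UNIV. \<Sum>j\<in>UNIV. p $ i * P $ i $ j * ?n j) = (\<Sum>j\<in>UNIV. p $ j * ?n j)"
    by (subst sum.swap) (simp add: * flip: sum_distrib_right)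
  finally show ?thesis by simp
qed

lemma pairing_matrix:
  "pairing \<phi> (map_matrix of_real N *v cnj_vec \<phi>) = (\<Sum>i\<in>UNIV. \<Sum>j\<in>UNIV. \<phi> $ i * of_real (N $ i $ j) * cnj (\<phi> $ j))"
  by (simp add: pairing_def matrix_vector_mult_def map_matrix_def cnj_vec_def sum_distrib_left mult.assoc)

lemma norm_complex_vec_square: "(norm (\<phi> :: complex^'n))\<^sup>2 = (\<Sum>i\<in>UNIV. (cmod (\<phi> $ i))\<^sup>2)"
  by (simp add: norm_vec_def L2_set_def sum_nonneg)

lemma mult_cnj_eq_cmod_square: "z * cnj z = (complex_of_real (cmod z))\<^sup>2"
  by (simp add: complex_norm_square flip: of_real_power)

lemma Re_pairing_killed_laplacian:
  assumes "is_laplacian Q"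
  shows "Re (pairing \<phi> (map_matrix of_real (Q - mat h) *v cnj_vec \<phi>)) \<le> - h * (norm \<phi>)\<^sup>2"
proof -
  have "(\<Sum>i\<in>UNIV. \<Sum>j\<in>UNIV. \<phi> $ i * of_real ((Q - mat h) $ i $ j) * cnj (\<phi> $ j)) =
      (\<Sum>i\<in>UNIV. \<Sum>j\<in>UNIV. \<phi> $ i * of_real (Q $ i $ j) * cnj (\<phi> $ j) - (if i = j then of_real h * (\<phi> $ i * cnj (\<phi> $ i)) else 0))"
    by (intro sum.cong refl) (auto simp: mat_def algebra_simps)
  also have "\<dots> = (\<Sum>i\<in>UNIV. \<Sum>j\<in>UNIV. \<phi> $ i * of_real (Q $ i $ j) * cnj (\<phi> $ j)) - of_real (h * (norm \<phi>)\<^sup>2)"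
    by (simp add: sum_subtractf sum_distrib_left norm_complex_vec_square mult_cnj_eq_cmod_square)
  finally show ?thesis
    using laplacian_form_nonpos[OF assms, of \<phi>] by (simp add: pairing_matrix)
qed

text \<open>The derivative of \<open>exp (S \<phi>)\<close> in the conjugate of
  \<open>\<phi> $ b\<close> has integral zero. As \<open>S\<close> is quadratic, this derivative
  brings down a factor affine in \<phi> and free of conjugates, so the first moments form a closed
  linear system.\<close>

lemma Gaussian_moment_equation:
  fixes Q :: "real^'n^'n" and v :: "real^'n" and h \<rho> :: real
  defines "S \<equiv> \<lambda>\<phi> :: complex^'n. pairing \<phi> (map_matrix of_real (Q - mat h) *v cnj_vec \<phi>) -
      of_real (v \<bullet> cmod2_vec (\<phi> + vec (of_real \<rho>)))"
  assumes Q: "is_laplacian Q" and h: "h > 0" and v: "\<And>i. v $ i \<ge> 0"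
  shows "integrable lborel (\<lambda>\<phi>. exp (S \<phi>))"
    and "integrable lborel (\<lambda>\<phi>. (\<phi> $ b + of_real \<rho>) * exp (S \<phi>))"
    and "(\<Sum>i\<in>UNIV. of_real ((mat h - Q) $ i $ b) * (\<integral>\<phi>. (\<phi> $ i + of_real \<rho>) * exp (S \<phi>) \<partial>lborel)) +
      of_real (v $ b) * (\<integral>\<phi>. (\<phi> $ b + of_real \<rho>) * exp (S \<phi>) \<partial>lborel) = of_real (\<rho> * h) * (\<integral>\<phi>. exp (S \<phi>) \<partial>lborel)"
proof -
  define N where "N i j = complex_of_real ((Q - mat h) $ i $ j)" for i j
  define \<psi> where "\<psi> \<phi> i = \<phi> $ i + complex_of_real \<rho>" for \<phi> :: "complex^'n" and i
  have S_eq: "S \<phi> = (\<Sum>i\<in>UNIV. \<Sum>j\<in>UNIV. \<phi> $ i * N i j * cnj (\<phi> $ j)) - (\<Sum>i\<in>UNIV. of_real (v $ i) * (\<psi> \<phi> i * cnj (\<psi> \<phi> i)))" for \<phi>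
    by (simp add: S_def pairing_matrix N_def \<psi>_def inner_vec_def cmod2_vec_def mult_cnj_eq_cmod_square del: complex_cnj_add)
  have cont_S: "continuous_on UNIV S"
    unfolding S_eq[abs_def] \<psi>_def by (intro continuous_intros)
  have Re_S: "Re (S \<phi>) \<le> - h * (norm \<phi>)\<^sup>2" for \<phi>
  proof -
    have "0 \<le> v \<bullet> cmod2_vec (\<phi> + vec (of_real \<rho>))"
      using v by (auto simp: inner_vec_def cmod2_vec_def intro!: sum_nonneg)
    then show ?thesis
      using Re_pairing_killed_laplacian[OF Q, of \<phi> h] by (simp add: S_def)
  qed
  have norm_S: "norm (exp (S \<phi>)) \<le> exp (- h * (norm \<phi>)\<^sup>2)" for \<phi>
    using Re_S[of \<phi>] by simp
  show int_S: "integrable lborel (\<lambda>\<phi>. exp (S \<phi>))"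
    using norm_S borel_measurable_continuous_onI[OF cont_S]
    by (intro integrable_Gaussian_bound[OF _ h, of _ 0 0]) auto
  have \<psi>_bound: "norm (\<psi> \<phi> i) \<le> \<bar>\<rho>\<bar> + norm \<phi>" for \<phi> i
    using norm_triangle_ineq[of "\<phi> $ i" "of_real \<rho>"] Finite_Cartesian_Product.norm_nth_le[of \<phi> i] by (simp add: \<psi>_def)
  have int_\<psi>: "integrable lborel (\<lambda>\<phi>. \<psi> \<phi> i * exp (S \<phi>))" for i
  proof (rule integrable_Gaussian_bound[OF _ h])
    show "(\<lambda>\<phi>. \<psi> \<phi> i * exp (S \<phi>)) \<in> borel_measurable borel"
      unfolding \<psi>_def by (intro borel_measurable_continuous_onI continuous_intros cont_S)
    fix \<phi>
    have "norm (\<psi> \<phi> i) \<le> exp (\<bar>\<rho>\<bar> + norm \<phi>)"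
      using \<psi>_bound[of \<phi> i] exp_ge_add_one_self[of "\<bar>\<rho>\<bar> + norm \<phi>"] by linarith
    then have "norm (\<psi> \<phi> i * exp (S \<phi>)) \<le> exp (\<bar>\<rho>\<bar> + norm \<phi>) * exp (- h * (norm \<phi>)\<^sup>2)"
      unfolding norm_mult by (intro mult_mono norm_S) auto
    then show "norm (\<psi> \<phi> i * exp (S \<phi>)) \<le> exp (\<bar>\<rho>\<bar> + 1 * norm \<phi> - h * (norm \<phi>)\<^sup>2)"
      by (simp flip: exp_add)
  qed
  then show "integrable lborel (\<lambda>\<phi>. (\<phi> $ b + of_real \<rho>) * exp (S \<phi>))"
    unfolding \<psi>_def .
  \<comment> \<open>\<open>X\<close> and \<open>Y\<close> are the Wirtinger derivatives of
    \<open>S\<close> in \<open>\<phi> $ b\<close> and in its conjugate; moving this coordinate in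
    the complex direction \<omega> changes \<open>S\<close> to first order by
    \<open>\<omega> * X \<phi> + cnj \<omega> * Y \<phi>\<close>.\<close>
  define X where "X \<phi> = (\<Sum>j\<in>UNIV. N b j * cnj (\<phi> $ j)) - of_real (v $ b) * cnj (\<psi> \<phi> b)" for \<phi>
  define Y where "Y \<phi> = (\<Sum>i\<in>UNIV. \<phi> $ i * N i b) - of_real (v $ b) * \<psi> \<phi> b" for \<phi>
  have deriv: "integrable lborel (\<lambda>\<phi>. (\<omega> * X \<phi> + cnj \<omega> * Y \<phi>) * exp (S \<phi>)) \<and>
      (\<integral>\<phi>. (\<omega> * X \<phi> + cnj \<omega> * Y \<phi>) * exp (S \<phi>) \<partial>lborel) = 0" for \<omega>
  proof -
    have shift: "S (\<phi> + t *\<^sub>R axis b \<omega>) = S \<phi> + of_real t * (\<omega> * X \<phi> + cnj \<omega> * Y \<phi>) +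
        of_real (t\<^sup>2) * (\<omega> * cnj \<omega> * (N b b - of_real (v $ b)))" for \<phi> t
    proof -
      let ?\<epsilon> = "\<lambda>i. if i = b then \<omega> else 0"
      have comp: "(\<phi> + t *\<^sub>R axis b \<omega>) $ i = \<phi> $ i + of_real t * ?\<epsilon> i" for i
        unfolding vector_add_component vector_scaleR_component by (simp add: axis_def scaleR_conv_of_real)
      have \<psi>_comp: "\<psi> (\<phi> + t *\<^sub>R axis b \<omega>) i = \<psi> \<phi> i + of_real t * ?\<epsilon> i" for i
        unfolding \<psi>_def comp by simp
      have "(\<Sum>i\<in>UNIV. \<Sum>j\<in>UNIV. (\<phi> $ i + of_real t * ?\<epsilon> i) * N i j * cnj (\<phi> $ j + of_real t * ?\<epsilon> j)) =
          (\<Sum>i\<in>UNIV. \<Sum>j\<in>UNIV. \<phi> $ i * N i j * cnj (\<phi> $ j)) +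
          (\<Sum>i\<in>UNIV. \<Sum>j\<in>UNIV. of_real t * ?\<epsilon> i * N i j * cnj (\<phi> $ j)) +
          (\<Sum>i\<in>UNIV. \<Sum>j\<in>UNIV. of_real t * \<phi> $ i * N i j * cnj (?\<epsilon> j)) +
          (\<Sum>i\<in>UNIV. \<Sum>j\<in>UNIV. of_real (t\<^sup>2) * ?\<epsilon> i * N i j * cnj (?\<epsilon> j))"
        unfolding sum.distrib[symmetric] by (intro sum.cong refl) (simp add: algebra_simps power2_eq_square)
      also have "(\<Sum>i\<in>UNIV. \<Sum>j\<in>UNIV. of_real t * ?\<epsilon> i * N i j * cnj (\<phi> $ j)) = of_real t * \<omega> * (\<Sum>j\<in>UNIV. N b j * cnj (\<phi> $ j))"
        by (subst sum.swap) (simp add: if_distrib[of "\<lambda>x. _ * x"] if_distrib[of "\<lambda>x. x * _"] sum_distrib_left mult.assoc cong: if_cong)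
      also have "(\<Sum>i\<in>UNIV. \<Sum>j\<in>UNIV. of_real t * \<phi> $ i * N i j * cnj (?\<epsilon> j)) = of_real t * cnj \<omega> * (\<Sum>i\<in>UNIV. \<phi> $ i * N i b)"
        by (simp add: if_distrib[of "\<lambda>x. _ * x"] if_distrib[of cnj] sum_distrib_left mult_ac cong: if_cong)
      also have "(\<Sum>i\<in>UNIV. \<Sum>j\<in>UNIV. of_real (t\<^sup>2) * ?\<epsilon> i * N i j * cnj (?\<epsilon> j)) = of_real (t\<^sup>2) * (\<omega> * cnj \<omega> * N b b)"
      proof -
        have "(\<Sum>j\<in>UNIV. of_real (t\<^sup>2) * ?\<epsilon> i * N i j * cnj (?\<epsilon> j)) =
            (if i = b then of_real (t\<^sup>2) * (\<omega> * cnj \<omega> * N b b) else 0)" for i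
          by (simp add: if_distrib[of "\<lambda>x. _ * x"] if_distrib[of cnj] mult_ac cong: if_cong)
        then show ?thesis by simp
      qed
      finally have quad: "(\<Sum>i\<in>UNIV. \<Sum>j\<in>UNIV. (\<phi> $ i + of_real t * ?\<epsilon> i) * N i j * cnj (\<phi> $ j + of_real t * ?\<epsilon> j)) =
          (\<Sum>i\<in>UNIV. \<Sum>j\<in>UNIV. \<phi> $ i * N i j * cnj (\<phi> $ j)) + of_real t * \<omega> * (\<Sum>j\<in>UNIV. N b j * cnj (\<phi> $ j)) +
          of_real t * cnj \<omega> * (\<Sum>i\<in>UNIV. \<phi> $ i * N i b) + of_real (t\<^sup>2) * (\<omega> * cnj \<omega> * N b b)" .
      have "(\<Sum>i\<in>UNIV. of_real (v $ i) * ((\<psi> \<phi> i + of_real t * ?\<epsilon> i) * cnj (\<psi> \<phi> i + of_real t * ?\<epsilon> i))) =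
          (\<Sum>i\<in>UNIV. of_real (v $ i) * (\<psi> \<phi> i * cnj (\<psi> \<phi> i)) +
            (if i = b then of_real (v $ b) * (of_real t * (\<omega> * cnj (\<psi> \<phi> b) + cnj \<omega> * \<psi> \<phi> b) + of_real (t\<^sup>2) * (\<omega> * cnj \<omega>)) else 0))"
        by (intro sum.cong refl) (simp add: algebra_simps power2_eq_square)
      also have "\<dots> = (\<Sum>i\<in>UNIV. of_real (v $ i) * (\<psi> \<phi> i * cnj (\<psi> \<phi> i))) +
          of_real (v $ b) * (of_real t * (\<omega> * cnj (\<psi> \<phi> b) + cnj \<omega> * \<psi> \<phi> b) + of_real (t\<^sup>2) * (\<omega> * cnj \<omega>))"
        by (simp add: sum.distrib)
      finally show ?thesis
        unfolding S_eq comp \<psi>_comp quad X_def Y_def by (simp add: algebra_simps)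
    qed
    define D where "D = cmod \<omega> * ((\<Sum>j\<in>UNIV. cmod (N b j)) + (\<Sum>i\<in>UNIV. cmod (N i b)) + 2 * v $ b)"
    have X_bound: "cmod (X \<phi>) \<le> (\<Sum>j\<in>UNIV. cmod (N b j)) * (\<bar>\<rho>\<bar> + norm \<phi>) + v $ b * (\<bar>\<rho>\<bar> + norm \<phi>)" for \<phi>
      unfolding X_def sum_distrib_right
    proof (intro order_trans[OF norm_triangle_ineq4] add_mono order_trans[OF norm_sum] sum_mono)
      show "cmod (N b j * cnj (\<phi> $ j)) \<le> cmod (N b j) * (\<bar>\<rho>\<bar> + norm \<phi>)" for j
        using Finite_Cartesian_Product.norm_nth_le[of \<phi> j] by (simp add: norm_mult mult_left_mono)
    qed (use \<psi>_bound[of \<phi> b] v[of b] in \<open>simp add: norm_mult mult_left_mono\<close>)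
    have Y_bound: "cmod (Y \<phi>) \<le> (\<Sum>i\<in>UNIV. cmod (N i b)) * (\<bar>\<rho>\<bar> + norm \<phi>) + v $ b * (\<bar>\<rho>\<bar> + norm \<phi>)" for \<phi>
      unfolding Y_def sum_distrib_right
    proof (intro order_trans[OF norm_triangle_ineq4] add_mono order_trans[OF norm_sum] sum_mono)
      show "cmod (\<phi> $ j * N j b) \<le> cmod (N j b) * (\<bar>\<rho>\<bar> + norm \<phi>)" for j
        using mult_left_mono[of "cmod (\<phi> $ j)" "\<bar>\<rho>\<bar> + norm \<phi>" "cmod (N j b)"] Finite_Cartesian_Product.norm_nth_le[of \<phi> j]
        by (simp add: norm_mult mult.commute)
    qed (use \<psi>_bound[of \<phi> b] v[of b] in \<open>simp add: norm_mult mult_left_mono\<close>)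
    have "cmod (\<omega> * X \<phi> + cnj \<omega> * Y \<phi>) \<le> cmod \<omega> * (cmod (X \<phi>) + cmod (Y \<phi>))" for \<phi>
      by (rule order_trans[OF norm_triangle_ineq]) (simp add: norm_mult algebra_simps)
    also have "cmod \<omega> * (cmod (X \<phi>) + cmod (Y \<phi>)) \<le> cmod \<omega> *
        (((\<Sum>j\<in>UNIV. cmod (N b j)) * (\<bar>\<rho>\<bar> + norm \<phi>) + v $ b * (\<bar>\<rho>\<bar> + norm \<phi>)) +
         ((\<Sum>i\<in>UNIV. cmod (N i b)) * (\<bar>\<rho>\<bar> + norm \<phi>) + v $ b * (\<bar>\<rho>\<bar> + norm \<phi>)))" for \<phi>
      using X_bound[of \<phi>] Y_bound[of \<phi>] by (intro mult_left_mono add_mono) auto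
    also have "\<dots> \<phi> = D * \<bar>\<rho>\<bar> + D * norm \<phi>" for \<phi>
      by (simp add: D_def algebra_simps)
    finally have bound: "cmod (\<omega> * X \<phi> + cnj \<omega> * Y \<phi>) \<le> D * \<bar>\<rho>\<bar> + D * norm \<phi>" for \<phi> .
    have "continuous_on UNIV (\<lambda>\<phi>. \<omega> * X \<phi> + cnj \<omega> * Y \<phi>)"
      unfolding X_def Y_def \<psi>_def by (intro continuous_intros)
    from integral_deriv_exp_quadratic[OF shift cont_S this h Re_S bound]
    show ?thesis by simp
  qed
  \<comment> \<open>The directions \<open>1\<close> and \<open>\<i>\<close> are weighted by
    \<open>1 / 2\<close> and \<open>\<i> / 2\<close> so that \<open>X\<close> cancels and the
    conjugate derivative remains.\<close>
  have "(\<lambda>\<phi>. Y \<phi> * exp (S \<phi>)) = (\<lambda>\<phi>. 1 / 2 * ((1 * X \<phi> + cnj 1 * Y \<phi>) * exp (S \<phi>)) +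
      \<i> / 2 * ((\<i> * X \<phi> + cnj \<i> * Y \<phi>) * exp (S \<phi>)))"
    by (simp add: fun_eq_iff algebra_simps)
  then have Y_0: "(\<integral>\<phi>. Y \<phi> * exp (S \<phi>) \<partial>lborel) = 0"
    using deriv[of 1] deriv[of \<i>]
    by (simp only: Bochner_Integration.integral_add integrable_mult_right integral_mult_right_zero) simp
  have "(\<Sum>i\<in>UNIV. (Q - mat h) $ i $ b) = - h"
    by (simp add: sum_subtractf laplacian_column_sum[OF Q] mat_def)
  then have "(\<Sum>i\<in>UNIV. N i b) = - of_real h"
    unfolding N_def by (metis of_real_minus of_real_sum)
  \<comment> \<open>Passing to the shifted variable \<psi> costs \<rho> times a column sum of
    \<open>N\<close>, which is \<open>- h\<close>. This is the origin of the inhomogeneity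
    \<open>\<rho> * h\<close>, the same for every \<open>b\<close>.\<close>
  moreover have "(\<Sum>i\<in>UNIV. \<phi> $ i * N i b) = (\<Sum>i\<in>UNIV. N i b * \<psi> \<phi> i) - of_real \<rho> * (\<Sum>i\<in>UNIV. N i b)" for \<phi>
    unfolding sum_distrib_left sum_subtractf[symmetric] by (intro sum.cong) (auto simp: \<psi>_def algebra_simps)
  ultimately have "Y \<phi> = (\<Sum>i\<in>UNIV. N i b * \<psi> \<phi> i) - of_real (v $ b) * \<psi> \<phi> b + of_real (\<rho> * h)" for \<phi>
    by (simp add: Y_def)
  then have "Y \<phi> * exp (S \<phi>) = (\<Sum>i\<in>UNIV. N i b * (\<psi> \<phi> i * exp (S \<phi>))) - of_real (v $ b) * (\<psi> \<phi> b * exp (S \<phi>)) +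
      of_real (\<rho> * h) * exp (S \<phi>)" for \<phi>
    by (simp only:) (simp add: distrib_right left_diff_distrib sum_distrib_right mult.assoc)
  then have "0 = (\<Sum>i\<in>UNIV. N i b * (\<integral>\<phi>. \<psi> \<phi> i * exp (S \<phi>) \<partial>lborel)) - of_real (v $ b) * (\<integral>\<phi>. \<psi> \<phi> b * exp (S \<phi>) \<partial>lborel) +
      of_real (\<rho> * h) * (\<integral>\<phi>. exp (S \<phi>) \<partial>lborel)"
    using Y_0 int_\<psi> int_S by simp
  moreover have "- A + B = C" if "0 = A - B + C" for A B C :: complex
    using that by (simp add: algebra_simps)
  moreover have "of_real ((mat h - Q) $ i $ b) = - N i b" for i
    by (simp add: N_def)
  ultimately show "(\<Sum>i\<in>UNIV. of_real ((mat h - Q) $ i $ b) * (\<integral>\<phi>. (\<phi> $ i + of_real \<rho>) * exp (S \<phi>) \<partial>lborel)) +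
      of_real (v $ b) * (\<integral>\<phi>. (\<phi> $ b + of_real \<rho>) * exp (S \<phi>) \<partial>lborel) = of_real (\<rho> * h) * (\<integral>\<phi>. exp (S \<phi>) \<partial>lborel)"
    by (simp only: \<psi>_def mult_minus_left sum_negf)
qed

section \<open>Density of exponentials\<close>

text \<open>An inductive predicate lets linear properties be proved by rule induction. The case
  \<open>v = 0\<close> supplies the constants.\<close>

inductive exp_span :: "(real^'n \<Rightarrow> complex) \<Rightarrow> bool" where
  exp_span_exp: "(\<And>i. v $ i \<ge> 0) \<Longrightarrow> exp_span (\<lambda>l. of_real (exp (- (v \<bullet> l))))"
| exp_span_scale: "exp_span f \<Longrightarrow> exp_span (\<lambda>l. c * f l)"
| exp_span_add: "exp_span f \<Longrightarrow> exp_span g \<Longrightarrow> exp_span (\<lambda>l. f l + g l)"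

lemma exp_span_0: "exp_span (\<lambda>l. 0)"
  using exp_span_scale[OF exp_span_exp[of 0], of 0] by simp

lemma exp_span_1: "exp_span (\<lambda>l. 1)"
  using exp_span_exp[of 0] by simp

lemma exp_span_sum:
  assumes "finite I" "\<And>i. i \<in> I \<Longrightarrow> exp_span (f i)"
  shows "exp_span (\<lambda>l. \<Sum>i\<in>I. f i l)"
  using assms by (induction I rule: finite_induct) (auto intro: exp_span_0 exp_span_add)

lemma exp_span_times_exp_component:
  assumes "exp_span f"
  shows "exp_span (\<lambda>l. of_real (exp (- (l $ i))) * f l)"
  using assms
proof (induction rule: exp_span.induct)
  case (exp_span_exp v)
  have "exp_span (\<lambda>l. of_real (exp (- ((v + axis i 1) \<bullet> l))))"
    using exp_span_exp by (intro exp_span.exp_span_exp) (auto simp: axis_def)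
  moreover have "exp (- ((v + axis i 1) \<bullet> l)) = exp (- (l $ i)) * exp (- (v \<bullet> l))" for l
    by (simp add: inner_add_left inner_axis' flip: exp_add)
  ultimately show ?case
    by simp
next
  case (exp_span_scale f c)
  from exp_span.exp_span_scale[OF exp_span_scale.IH, of c] show ?case
    by (simp add: mult_ac)
next
  case (exp_span_add f g)
  from exp_span.exp_span_add[OF exp_span_add.IH] show ?case
    by (simp add: distrib_left)
qed

text \<open>Multiplication by one coordinate exponential adds a unit vector to \<open>v\<close>, so
  polynomials in these exponentials act on the span. Keeping \<open>f\<close> general lets a product
  of polynomials act by two successive multiplications.\<close>

lemma exp_span_times_polynomial:
  assumes "real_polynomial_function p" "exp_span f"
  shows "exp_span (\<lambda>l. of_real (p (\<chi> i. exp (- (l $ i)))) * f l)"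
  using assms
proof (induction arbitrary: f rule: real_polynomial_function.induct)
  case (linear p)
  have p_eq: "p x = (\<Sum>i\<in>UNIV. p (axis i 1) * x $ i)" for x
  proof -
    have "p x = p (\<Sum>i\<in>UNIV. x $ i *\<^sub>R axis i 1)"
      using basis_expansion[of x] by (simp add: scalar_mult_eq_scaleR)
    then show ?thesis
      using linear.hyps by (simp add: linear_sum linear_scale bounded_linear.linear mult.commute)
  qed
  have "of_real (p (\<chi> i. exp (- (l $ i)))) * f l =
      (\<Sum>i\<in>UNIV. of_real (p (axis i 1)) * (of_real (exp (- (l $ i))) * f l))" for l
    by (subst p_eq) (simp add: sum_distrib_right mult.assoc)
  moreover have "exp_span (\<lambda>l. \<Sum>i\<in>UNIV. of_real (p (axis i 1)) * (of_real (exp (- (l $ i))) * f l))"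
    by (rule exp_span_sum, simp, rule exp_span_scale, rule exp_span_times_exp_component, rule linear.prems)
  ultimately show ?case
    by simp
next
  case (add p q)
  then show ?case
    using exp_span_add[OF add.IH] by (simp add: distrib_right)
next
  case (mult p q)
  from mult.IH(1)[OF mult.IH(2)[OF mult.prems]] show ?case
    by (simp add: mult.assoc)
qed (auto intro: exp_span_scale)

lemma exp_span_continuous: "exp_span f \<Longrightarrow> continuous_on S f"
  by (induction rule: exp_span.induct) (auto intro!: continuous_intros)

lemma exp_span_bounded: "exp_span f \<Longrightarrow> \<exists>B. \<forall>l\<in>orthant. cmod (f l) \<le> B"
proof (induction rule: exp_span.induct)
  case (exp_span_exp v)
  then have "v \<bullet> l \<ge> 0" if "l \<in> orthant" for l
    using that by (auto simp: inner_vec_def orthant_def intro!: sum_nonneg)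
  then show ?case by (intro exI[of _ 1]) simp
next
  case (exp_span_scale f c)
  then obtain B where "\<forall>l\<in>orthant. cmod (f l) \<le> B" by auto
  then show ?case by (intro exI[of _ "cmod c * B"]) (simp add: norm_mult mult_left_mono)
next
  case (exp_span_add f g)
  then obtain B C where "\<forall>l\<in>orthant. cmod (f l) \<le> B" "\<forall>l\<in>orthant. cmod (g l) \<le> C" by auto
  then show ?case by (intro exI[of _ "B + C"]) (auto intro: norm_triangle_mono)
qed

text \<open>Under \<open>x\<^sub>i = exp (- l\<^sub>i)\<close> the orthant becomes the half-open cube \<open>(0,1]\<^sup>n\<close>, a function vanishing at
  infinity extends by zero to the closed cube, and exponentials become monomials.\<close>

lemma exp_span_dense:
  fixes u :: "real^'n \<Rightarrow> complex"
  assumes cont: "continuous_on orthant u"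
    and decay: "\<And>e. e > 0 \<Longrightarrow> \<exists>R. \<forall>l\<in>orthant. norm l \<ge> R \<longrightarrow> cmod (u l) < e"
    and "e > 0"
  obtains k where "exp_span k" "\<And>l. l \<in> orthant \<Longrightarrow> cmod (u l - k l) < e"
proof -
  define C where "C = cbox (0 :: real^'n) 1"
  have C: "x \<in> C \<longleftrightarrow> (\<forall>i. 0 \<le> x $ i \<and> x $ i \<le> 1)" for x
    by (simp add: C_def mem_box_cart)
  define w where "w x = (if \<forall>i. 0 < x $ i then u (\<chi> i. - ln (x $ i)) else 0)" for x
  have "continuous_on C w"
    unfolding continuous_on_def
  proof
    fix x assume x: "x \<in> C"
    have comp: "((\<lambda>y. y $ i) \<longlongrightarrow> x $ i) (at x within C)" for i
      by (intro tendsto_intros)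
    have inC: "\<forall>\<^sub>F y in at x within C. y \<in> C"
      by (simp add: eventually_at_filter)
    show "(w \<longlongrightarrow> w x) (at x within C)"
    proof (cases "\<forall>i. 0 < x $ i")
      case True
      have pos: "\<forall>\<^sub>F y in at x within C. \<forall>i. 0 < y $ i"
        using True by (intro eventually_all_finite order_tendstoD(1)[OF comp]) auto
      have "((\<lambda>y. u (\<chi> i. - ln (y $ i))) \<longlongrightarrow> u (\<chi> i. - ln (x $ i))) (at x within C)"
      proof (rule continuous_on_tendsto_compose[OF cont])
        show "((\<lambda>y. \<chi> i. - ln (y $ i)) \<longlongrightarrow> (\<chi> i. - ln (x $ i))) (at x within C)"
          using True by (intro tendsto_vec_lambda tendsto_intros comp) (auto simp: less_imp_neq[symmetric])
        show "(\<chi> i. - ln (x $ i)) \<in> orthant"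
          using True x by (auto simp: orthant_def C)
        show "\<forall>\<^sub>F y in at x within C. (\<chi> i. - ln (y $ i)) \<in> orthant"
          using pos inC by eventually_elim (auto simp: orthant_def C)
      qed
      moreover have "\<forall>\<^sub>F y in at x within C. u (\<chi> i. - ln (y $ i)) = w y"
        using pos by eventually_elim (simp add: w_def)
      ultimately show ?thesis
        using True by (simp add: w_def[of x] filterlim_cong tendsto_cong)
    next
      case False
      \<comment> \<open>Near such a face \<open>- ln (y $ i)\<close> is large, and one large
        coordinate already makes the norm large, so the decay of \<open>u\<close> applies.
        Neighbouring points on a face have value zero by definition of \<open>w\<close>.\<close>
      then obtain i where i: "x $ i = 0"
        using x by (auto simp: C not_less intro: antisym)
      have "\<forall>\<^sub>F y in at x within C. dist (w y) 0 < e'" if e': "e' > 0" for e'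
      proof -
        obtain R where R: "\<And>l. l \<in> orthant \<Longrightarrow> norm l \<ge> R \<Longrightarrow> cmod (u l) < e'"
          using decay[OF e'] by auto
        have "\<forall>\<^sub>F y in at x within C. y $ i < exp (- R)"
          using comp[of i] i by (intro order_tendstoD(2)[of _ "x $ i"]) auto
        then show ?thesis
          using inC
        proof eventually_elim
          case (elim y)
          show ?case
          proof (cases "\<forall>i. 0 < y $ i")
            case True
            have "R \<le> - ln (y $ i)"
              using elim(1) True ln_less_cancel_iff[of "y $ i" "exp (- R)"] by simp
            also have "\<dots> \<le> norm (\<chi> i. - ln (y $ i))"
              using component_le_norm_cart[of "\<chi> i. - ln (y $ i)" i] by simp
            finally have "cmod (u (\<chi> i. - ln (y $ i))) < e'"
              using elim(2) True by (intro R) (auto simp: orthant_def C)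
            then show ?thesis
              using True by (simp add: w_def)
          next
            case False
            then have "w y = 0" unfolding w_def by (rule if_not_P)
            then show ?thesis using e' by simp
          qed
        qed
      qed
      moreover have "w x = 0"
        using False unfolding w_def by (rule if_not_P)
      ultimately show ?thesis
        by (simp add: tendsto_iff)
    qed
  qed
  moreover have "compact C"
    by (simp add: C_def)
  ultimately obtain p where p: "polynomial_function p" "\<And>x. x \<in> C \<Longrightarrow> norm (w x - p x) < e"
    using Stone_Weierstrass_polynomial_function[of C w e] \<open>e > 0\<close> by blast
  let ?E = "\<lambda>l :: real^'n. \<chi> i. exp (- (l $ i))"
  \<comment> \<open>The approximant is complex-valued; its real and imaginary parts are treated
    separately and recombined with the scalar \<open>\<i>\<close>.\<close>
  have "real_polynomial_function (\<lambda>x. Re (p x))" "real_polynomial_function (\<lambda>x. Im (p x))"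
    using p(1) bounded_linear_Re bounded_linear_Im by (auto simp: polynomial_function_def o_def)
  from this[THEN exp_span_times_polynomial[OF _ exp_span_1]]
  have "exp_span (\<lambda>l. of_real (Re (p (?E l))) * 1 + \<i> * (of_real (Im (p (?E l))) * 1))"
    using exp_span_add exp_span_scale by blast
  then have "exp_span (\<lambda>l. p (?E l))"
    by (simp flip: complex_eq)
  moreover have "cmod (u l - p (?E l)) < e" if "l \<in> orthant" for l
  proof -
    have "?E l \<in> C"
      using that by (simp add: C orthant_def)
    moreover have "w (?E l) = u l"
      by (simp add: w_def)
    ultimately show ?thesis
      using p(2) by metis
  qed
  ultimately show ?thesis
    by (rule that)
qed

section \<open>The identity for general test functions\<close>

lemma closed_orthant: "closed (orthant :: (real^'n) set)"
proof -
  have "orthant = (\<Inter>i. {l :: real^'n. 0 \<le> l $ i})"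
    by (auto simp: orthant_def)
  moreover have "closed (\<Inter>i. {l :: real^'n. 0 \<le> l $ i})"
    by (intro closed_INT ballI closed_Collect_le continuous_intros)
  ultimately show ?thesis by simp
qed

lemma orthant_add: "k \<in> orthant \<Longrightarrow> l \<in> orthant \<Longrightarrow> k + l \<in> orthant"
  by (simp add: orthant_def)

lemma cmod2_vec_orthant: "cmod2_vec \<phi> \<in> orthant"
  by (simp add: cmod2_vec_def orthant_def)

lemma continuous_cmod2_vec: "continuous_on S (\<lambda>\<phi>. cmod2_vec (\<phi> + c))"
  unfolding cmod2_vec_def by (intro continuous_on_vec_lambda continuous_intros)

text \<open>\<open>L\<close> stands for the local time at \<zeta> and \<rho> for
  \<open>sqrt r\<close>. The approximation argument sees the process only through a measurable
  variable with values in the orthant.\<close>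

locale Gaussian_shift =
  fixes Q :: "real^'n^'n" and M :: "'w measure" and L :: "'w \<Rightarrow> real^'n" and a :: 'n and h \<rho> :: real
  assumes Q: "is_laplacian Q" and h: "h > 0" and \<rho>: "\<rho> > 0"
    and M: "prob_space M"
    and L_measurable [measurable]: "L \<in> borel_measurable M"
    and L_orthant: "L \<omega> \<in> orthant"

sublocale Gaussian_shift \<subseteq> prob_space M
  by (rule M)

context Gaussian_shift
begin

abbreviation U :: "complex^'n \<Rightarrow> real^'n" where
  "U \<phi> \<equiv> cmod2_vec (\<phi> + vec (of_real \<rho>))"

definition lhs_integrand :: "(real^'n \<Rightarrow> complex) \<Rightarrow> complex^'n \<Rightarrow> complex" where
  "lhs_integrand u \<phi> = (\<phi> $ a + of_real \<rho>) / of_real \<rho> * u (U \<phi>) * gauss_density Q h \<phi>"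

definition rhs_integrand :: "(real^'n \<Rightarrow> complex) \<Rightarrow> complex^'n \<Rightarrow> complex" where
  "rhs_integrand u \<phi> = (\<integral>\<omega>. u (U \<phi> + L \<omega>) \<partial>M) * gauss_density Q h \<phi>"

text \<open>A class on which both integrals exist. It contains the approximating exponentials and
  the approximation errors; conditions are imposed on the orthant because all arguments of
  \<open>u\<close> lie there.\<close>

definition admissible :: "(real^'n \<Rightarrow> complex) \<Rightarrow> bool" where
  "admissible u \<longleftrightarrow> continuous_on orthant u \<and> (\<exists>B. \<forall>l\<in>orthant. cmod (u l) \<le> B)"

lemma exp_span_admissible: "exp_span u \<Longrightarrow> admissible u"
  by (simp add: admissible_def exp_span_continuous exp_span_bounded)

lemma gauss_density_integrable: "integrable lborel (gauss_density Q h)"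
  and gauss_density_component_integrable: "integrable lborel (\<lambda>\<phi>. (\<phi> $ a + of_real \<rho>) / of_real \<rho> * gauss_density Q h \<phi>)"
proof -
  have 1: "gauss_density Q h = (\<lambda>\<phi>. of_real (det (mat h - Q) / pi ^ CARD('n)) *
      exp (pairing \<phi> (map_matrix of_real (Q - mat h) *v cnj_vec \<phi>) - of_real (0 \<bullet> U \<phi>)))"
    by (simp add: gauss_density_def fun_eq_iff)
  have 2: "(\<lambda>\<phi>. (\<phi> $ a + of_real \<rho>) / of_real \<rho> * gauss_density Q h \<phi>) = (\<lambda>\<phi>. of_real (det (mat h - Q) / pi ^ CARD('n)) / of_real \<rho> *
      ((\<phi> $ a + of_real \<rho>) * exp (pairing \<phi> (map_matrix of_real (Q - mat h) *v cnj_vec \<phi>) - of_real (0 \<bullet> U \<phi>))))"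
    by (simp add: gauss_density_def fun_eq_iff mult_ac)
  show "integrable lborel (gauss_density Q h)"
    unfolding 1 by (intro integrable_mult_right Gaussian_moment_equation(1) Q h) simp
  show "integrable lborel (\<lambda>\<phi>. (\<phi> $ a + of_real \<rho>) / of_real \<rho> * gauss_density Q h \<phi>)"
    unfolding 2 by (intro integrable_mult_right Gaussian_moment_equation(2) Q h) simp
qed

text \<open>Nothing is known about \<open>u\<close> off the orthant. For the second claim
  \<open>u\<close> is therefore cut off by the indicator of this closed set, which
  \<open>U \<phi> + L \<omega>\<close> never leaves.\<close>

lemma admissible_measurable:
  assumes "admissible u"
  shows "(\<lambda>\<phi>. u (U \<phi>)) \<in> borel_measurable borel"
    and "(\<lambda>z. u (U (fst z) + L (snd z))) \<in> borel_measurable (borel \<Otimes>\<^sub>M M)"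
proof -
  have u: "continuous_on orthant u"
    using assms by (simp add: admissible_def)
  show "(\<lambda>\<phi>. u (U \<phi>)) \<in> borel_measurable borel"
    by (intro borel_measurable_continuous_onI continuous_on_compose2[OF u] continuous_cmod2_vec) (auto simp: cmod2_vec_orthant)
  have ind: "(\<lambda>l. indicator orthant l *\<^sub>R u l) \<in> borel_measurable borel"
    by (intro borel_measurable_continuous_on_indicator u borel_closed closed_orthant)
  have "U \<in> borel_measurable borel"
    by (intro borel_measurable_continuous_onI continuous_cmod2_vec)
  then have "(\<lambda>z. U (fst z) + L (snd z)) \<in> borel_measurable (borel \<Otimes>\<^sub>M M)"
    by measurable
  from measurable_compose[OF this ind]
  show "(\<lambda>z. u (U (fst z) + L (snd z))) \<in> borel_measurable (borel \<Otimes>\<^sub>M M)"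
    by (simp add: cmod2_vec_orthant L_orthant orthant_add)
qed

lemma admissible_integrable:
  assumes "admissible u"
  shows "integrable M (\<lambda>\<omega>. u (U \<phi> + L \<omega>))"
proof -
  obtain B where "\<forall>l\<in>orthant. cmod (u l) \<le> B"
    using assms by (auto simp: admissible_def)
  then show ?thesis
    using measurable_compose[OF measurable_Pair1'[of \<phi>] admissible_measurable(2)[OF assms]]
    by (intro integrable_const_bound[of _ B]) (auto simp: cmod2_vec_orthant L_orthant orthant_add)
qed

lemma expectation_bound:
  assumes "admissible u" "\<And>l. l \<in> orthant \<Longrightarrow> cmod (u l) \<le> B"
  shows "cmod (\<integral>\<omega>. u (U \<phi> + L \<omega>) \<partial>M) \<le> B"
proof -
  have "cmod (\<integral>\<omega>. u (U \<phi> + L \<omega>) \<partial>M) \<le> (\<integral>\<omega>. cmod (u (U \<phi> + L \<omega>)) \<partial>M)"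
    by (rule integral_norm_bound)
  also have "\<dots> \<le> (\<integral>\<omega>. B \<partial>M)"
    using assms by (intro integral_mono admissible_integrable integrable_norm)
      (auto simp: cmod2_vec_orthant L_orthant orthant_add)
  finally show ?thesis by (simp add: prob_space)
qed

lemma lhs_integrand_bound:
  assumes "\<And>l. l \<in> orthant \<Longrightarrow> cmod (u l) \<le> B"
  shows "cmod (lhs_integrand u \<phi>) \<le> B * cmod ((\<phi> $ a + of_real \<rho>) / of_real \<rho> * gauss_density Q h \<phi>)"
proof -
  have "lhs_integrand u \<phi> = u (U \<phi>) * ((\<phi> $ a + of_real \<rho>) / of_real \<rho> * gauss_density Q h \<phi>)"
    by (simp add: lhs_integrand_def)
  then show ?thesis
    by (simp only: norm_mult[of "u _"]) (intro mult_right_mono assms cmod2_vec_orthant norm_ge_zero)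
qed

lemma rhs_integrand_bound:
  assumes "admissible u" "\<And>l. l \<in> orthant \<Longrightarrow> cmod (u l) \<le> B"
  shows "cmod (rhs_integrand u \<phi>) \<le> B * cmod (gauss_density Q h \<phi>)"
  unfolding rhs_integrand_def norm_mult by (intro mult_right_mono expectation_bound assms) auto

lemma integrands_integrable:
  assumes u: "admissible u"
  shows "integrable lborel (lhs_integrand u)" "integrable lborel (rhs_integrand u)"
proof -
  obtain B where B: "\<And>l. l \<in> orthant \<Longrightarrow> cmod (u l) \<le> B"
    using assms by (auto simp: admissible_def)
  have [measurable]: "gauss_density Q h \<in> borel_measurable borel"
    using borel_measurable_integrable[OF gauss_density_integrable] by simp
  show "integrable lborel (lhs_integrand u)"
  proof (rule Bochner_Integration.integrable_bound)
    show "integrable lborel (\<lambda>\<phi>. B * cmod ((\<phi> $ a + of_real \<rho>) / of_real \<rho> * gauss_density Q h \<phi>))"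
      by (intro integrable_mult_right integrable_norm gauss_density_component_integrable)
    have "(\<lambda>\<phi> :: complex^'n. (\<phi> $ a + of_real \<rho>) / of_real \<rho>) \<in> borel_measurable borel"
      using \<rho> by (intro borel_measurable_continuous_onI continuous_intros) auto
    then show "lhs_integrand u \<in> borel_measurable lborel"
      unfolding lhs_integrand_def[abs_def] using admissible_measurable(1)[OF u] by measurable
    show "AE \<phi> in lborel. cmod (lhs_integrand u \<phi>) \<le> norm (B * cmod ((\<phi> $ a + of_real \<rho>) / of_real \<rho> * gauss_density Q h \<phi>))"
      using order_trans[OF lhs_integrand_bound[OF B] abs_ge_self] by simp
  qed
  show "integrable lborel (rhs_integrand u)"
  proof (rule Bochner_Integration.integrable_bound)
    show "integrable lborel (\<lambda>\<phi>. B * cmod (gauss_density Q h \<phi>))"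
      by (intro integrable_mult_right integrable_norm gauss_density_integrable)
    have "(\<lambda>\<phi>. \<integral>\<omega>. u (U \<phi> + L \<omega>) \<partial>M) \<in> borel_measurable borel"
      using admissible_measurable(2)[OF u] by (intro borel_measurable_lebesgue_integral) (simp add: case_prod_beta')
    then show "rhs_integrand u \<in> borel_measurable lborel"
      unfolding rhs_integrand_def[abs_def] by measurable
    show "AE \<phi> in lborel. cmod (rhs_integrand u \<phi>) \<le> norm (B * cmod (gauss_density Q h \<phi>))"
      using order_trans[OF rhs_integrand_bound[OF u B] abs_ge_self] by simp
  qed
qed

text \<open>The identity becomes the vanishing of a linear functional, which can be tested on a
  dense set.\<close>

definition defect :: "(real^'n \<Rightarrow> complex) \<Rightarrow> complex" where
  "defect u = (\<integral>\<phi>. lhs_integrand u \<phi> \<partial>lborel) - (\<integral>\<phi>. rhs_integrand u \<phi> \<partial>lborel)"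

lemma defect_scale: "defect (\<lambda>l. c * u l) = c * defect u"
  unfolding defect_def lhs_integrand_def rhs_integrand_def by (simp add: mult_ac right_diff_distrib)

lemma defect_add:
  assumes "admissible u" "admissible w"
  shows "defect (\<lambda>l. u l + w l) = defect u + defect w"
proof -
  have "lhs_integrand (\<lambda>l. u l + w l) = (\<lambda>\<phi>. lhs_integrand u \<phi> + lhs_integrand w \<phi>)"
    by (simp add: lhs_integrand_def fun_eq_iff algebra_simps add_divide_distrib)
  moreover have "rhs_integrand (\<lambda>l. u l + w l) = (\<lambda>\<phi>. rhs_integrand u \<phi> + rhs_integrand w \<phi>)"
    using assms by (simp add: rhs_integrand_def fun_eq_iff distrib_right admissible_integrable)
  ultimately show ?thesis
    using assms by (simp add: defect_def integrands_integrable)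
qed

text \<open>This is continuity for the supremum norm. The constant adds the L1 norms of the density
  with and without the shifted coordinate; averaging over \<open>L\<close> costs nothing under a
  probability measure.\<close>

lemma defect_bound:
  assumes u: "admissible u" "\<And>l. l \<in> orthant \<Longrightarrow> cmod (u l) \<le> B"
  shows "cmod (defect u) \<le> B * ((\<integral>\<phi>. cmod ((\<phi> $ a + of_real \<rho>) / of_real \<rho> * gauss_density Q h \<phi>) \<partial>lborel) +
    (\<integral>\<phi>. cmod (gauss_density Q h \<phi>) \<partial>lborel))"
proof -
  have "cmod (\<integral>\<phi>. lhs_integrand u \<phi> \<partial>lborel) \<le> (\<integral>\<phi>. B * cmod ((\<phi> $ a + of_real \<rho>) / of_real \<rho> * gauss_density Q h \<phi>) \<partial>lborel)"
    by (intro order_trans[OF integral_norm_bound] integral_mono integrable_norm integrands_integrable u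
        integrable_mult_right gauss_density_component_integrable lhs_integrand_bound)
  moreover have "cmod (\<integral>\<phi>. rhs_integrand u \<phi> \<partial>lborel) \<le> (\<integral>\<phi>. B * cmod (gauss_density Q h \<phi>) \<partial>lborel)"
    by (intro order_trans[OF integral_norm_bound] integral_mono integrable_norm integrands_integrable u
        integrable_mult_right gauss_density_integrable rhs_integrand_bound)
  ultimately show ?thesis
    unfolding defect_def using norm_triangle_ineq4[of "\<integral>\<phi>. lhs_integrand u \<phi> \<partial>lborel" "\<integral>\<phi>. rhs_integrand u \<phi> \<partial>lborel"]
    by (simp add: distrib_left)
qed

lemma defect_eq_0:
  assumes exp: "\<And>v. (\<And>i. v $ i \<ge> 0) \<Longrightarrow> defect (\<lambda>l. of_real (exp (- (v \<bullet> l)))) = 0"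
    and cont: "continuous_on orthant u"
    and decay: "\<And>e. e > 0 \<Longrightarrow> \<exists>R. \<forall>l\<in>orthant. norm l \<ge> R \<longrightarrow> cmod (u l) < e"
  shows "defect u = 0"
proof -
  have span: "defect k = 0" if "exp_span k" for k
    using that
    by (induction rule: exp_span.induct) (simp_all add: exp defect_scale defect_add exp_span_admissible)
  define C where "C = (\<integral>\<phi>. cmod ((\<phi> $ a + of_real \<rho>) / of_real \<rho> * gauss_density Q h \<phi>) \<partial>lborel) +
    (\<integral>\<phi>. cmod (gauss_density Q h \<phi>) \<partial>lborel)"
  have "cmod (defect u) \<le> e * C" if e: "e > 0" for e
  proof -
    obtain k where k: "exp_span k" "\<And>l. l \<in> orthant \<Longrightarrow> cmod (u l - k l) < e"
      using exp_span_dense[OF cont decay e] by metis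
    have adm_diff: "admissible (\<lambda>l. u l - k l)"
      unfolding admissible_def
      by (intro conjI continuous_on_diff cont exp_span_continuous exI[of _ e] ballI less_imp_le k)
    \<comment> \<open>Additivity asks for admissible summands, and \<open>u - k\<close> is bounded
      by \<open>e\<close> by construction.\<close>
    have "defect (\<lambda>l. k l + (u l - k l)) = defect k + defect (\<lambda>l. u l - k l)"
      by (intro defect_add exp_span_admissible k adm_diff)
    then have "defect u = defect (\<lambda>l. u l - k l)"
      using span[OF k(1)] by simp
    then show ?thesis
      unfolding C_def using k(2) by (simp only:) (intro defect_bound adm_diff less_imp_le)
  qed
  from this[of "inverse (real (Suc n))" for n] have "cmod (defect u) \<le> inverse (real (Suc n)) * C" for n
    by simp
  moreover have "(\<lambda>n. inverse (real (Suc n)) * C) \<longlonglongrightarrow> 0 * C"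
    by (intro tendsto_mult tendsto_const LIMSEQ_inverse_real_of_nat)
  ultimately have "cmod (defect u) \<le> 0 * C"
    by (intro LIMSEQ_le_const) auto
  then show ?thesis by simp
qed

end

lemma property_F_decay:
  assumes "property_F u" "e > 0"
  shows "\<exists>R. \<forall>l\<in>orthant. norm l \<ge> R \<longrightarrow> cmod (u l) < e"
proof -
  have "sub_polynomial_tails (iterated_partial [] u)"
    using assms(1) by (auto simp: property_F_def)
  then obtain c where c: "c > 0" "\<And>l. l \<in> orthant - {0} \<Longrightarrow> cmod (u l) \<le> c * norm l powr (- 1)"
    unfolding sub_polynomial_tails_def iterated_partial_def by (metis foldr.simps(1) id_apply zero_less_one)
  show ?thesis
  proof (intro exI ballI impI)
    \<comment> \<open>The constant \<open>c\<close> belongs to the tail exponent 1. The threshold is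
      positive and so excludes the origin, where the tail bound is void; its factor 2 leaves room
      for a strict inequality.\<close>
    fix l :: "real^'a" assume l: "l \<in> orthant" "norm l \<ge> 2 * c / e"
    have pos: "norm l > 0"
      using l(2) c(1) assms(2) by (smt (verit) divide_pos_pos)
    then have "cmod (u l) \<le> c / norm l"
      using c(2)[of l] l(1) by (auto simp: powr_minus divide_inverse)
    also have "\<dots> \<le> e / 2"
      using l(2) pos assms(2) by (simp add: field_simps)
    also have "\<dots> < e"
      using assms(2) by simp
    finally show "cmod (u l) < e" .
  qed
qed

lemma property_F_continuous: "property_F u \<Longrightarrow> continuous_on orthant u"
  unfolding property_F_def smooth_on_orthant_def iterated_partial_def
  by (metis foldr.simps(1) id_apply)

theorem theorem3p5:
  fixes Q :: "real^'n^'n"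
    and M :: "'w measure"
    and X :: "real \<Rightarrow> 'w \<Rightarrow> 'n"
    and \<zeta> :: "'w \<Rightarrow> real"
    and u :: "real^'n \<Rightarrow> complex"
    and a :: 'n
    and h r :: real
  assumes "is_laplacian Q"
    and "h > 0"
    and "markov_chain M X (transpose Q)"
    and "AE \<omega> in M. X 0 \<omega> = a"
    and "distributed M lborel \<zeta> (exponential_density h)"
    and "independent_of_process M X \<zeta>"
    and "property_F u"
    and "r > 0"
  shows "gauss_integral Q h (\<lambda>\<phi>.
             (\<phi> $ a + of_real (sqrt r)) / of_real (sqrt r) *
             u (cmod2_vec (\<phi> + vec (of_real (sqrt r))))) =
         gauss_integral Q h (\<lambda>\<phi>.
             \<integral>\<omega>. u (cmod2_vec (\<phi> + vec (of_real (sqrt r))) + local_time X (\<zeta> \<omega>) \<omega>) \<partial>M)"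
proof -
  define \<rho> where "\<rho> = sqrt r"
  define L where "L \<omega> = local_time X (\<zeta> \<omega>) \<omega>" for \<omega>
  have \<rho>: "\<rho> > 0"
    using assms(8) by (simp add: \<rho>_def)
  interpret R: right_continuous_process M X
    using assms(3) by unfold_locales (auto simp: markov_chain_def)
  have "\<zeta> \<in> borel_measurable M"
    using distributed_measurable[OF assms(5)] by simp
  then have "(\<lambda>\<omega>. (\<zeta> \<omega>, \<omega>)) \<in> measurable M (borel \<Otimes>\<^sub>M M)"
    by measurable
  from measurable_compose[OF this R.measurable_local_time]
  have L: "L \<in> borel_measurable M"
    by (simp add: L_def[abs_def])
  have M: "prob_space M"
    using assms(3) by (simp add: markov_chain_def)
  interpret G: Gaussian_shift Q M L a h \<rho>
    by (rule Gaussian_shift.intro[OF assms(1,2) \<rho> M L]) (simp add: L_def local_time_nonneg)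
  have "G.defect (\<lambda>l. of_real (exp (- (v \<bullet> l)))) = 0" if v: "\<And>i. v $ i \<ge> 0" for v
  proof -
    interpret K: killed_markov_chain M X "transpose Q" a v h
      by (rule killed_markov_chain.intro[OF assms(3,4) v assms(2)])
    define S where "S \<phi> = pairing \<phi> (map_matrix of_real (Q - mat h) *v cnj_vec \<phi>) -
        of_real (v \<bullet> cmod2_vec (\<phi> + vec (of_real \<rho>)))" for \<phi>
    define K0 where "K0 = complex_of_real (det (mat h - Q) / pi ^ CARD('n))"
    define m where "m i = (\<integral>\<phi>. (\<phi> $ i + of_real \<rho>) * exp (S \<phi>) \<partial>lborel)" for i
    define E where "E = (\<integral>\<phi>. exp (S \<phi>) \<partial>lborel)"
    define \<gamma> where "\<gamma> i = complex_of_real (K.green i)" for i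
    have moment: "(\<Sum>i\<in>UNIV. of_real ((mat h - Q) $ i $ b) * m i) + of_real (v $ b) * m b = of_real (\<rho> * h) * E" for b
      using Gaussian_moment_equation(3)[OF assms(1,2) v, of b \<rho>] unfolding m_def E_def S_def .
    \<comment> \<open>The Green equation for \<open>transpose Q\<close> is rewritten with the same
      entries \<open>(mat h - Q) $ i $ b\<close> as in \<open>moment\<close>, now summed over
      \<open>b\<close>.\<close>
    have kac: "(\<Sum>b\<in>UNIV. \<gamma> b * of_real ((mat h - Q) $ i $ b)) + \<gamma> i * of_real (v $ i) = (if i = a then 1 else 0)" for i
    proof -
      have "(\<Sum>b\<in>UNIV. K.green b * (mat h - Q) $ i $ b) =
          (\<Sum>b\<in>UNIV. (if i = b then h * K.green b else 0) - K.green b * transpose Q $ b $ i)"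
        by (intro sum.cong) (auto simp: mat_def transpose_def algebra_simps)
      then have "(\<Sum>b\<in>UNIV. K.green b * (mat h - Q) $ i $ b) + K.green i * v $ i = (if i = a then 1 else 0)"
        using K.green_equation[of i] by (simp add: sum_subtractf mult.commute)
      then have "complex_of_real ((\<Sum>b\<in>UNIV. K.green b * (mat h - Q) $ i $ b) + K.green i * v $ i) = (if i = a then 1 else 0)"
        by simp
      then show ?thesis
        by (simp add: \<gamma>_def del: vector_minus_component)
    qed
    \<comment> \<open>Inserting \<open>kac\<close> for the unit vector and exchanging the sums moves
      the matrix from \<gamma> to \<open>m\<close>, where \<open>moment\<close> evaluates
      it.\<close>
    have "m a = (\<Sum>i\<in>UNIV. (if i = a then 1 else 0) * m i)"
      by (simp add: if_distrib[of "\<lambda>x. x * _"] cong: if_cong)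
    also have "\<dots> = (\<Sum>i\<in>UNIV. \<Sum>b\<in>UNIV. \<gamma> b * of_real ((mat h - Q) $ i $ b) * m i) + (\<Sum>i\<in>UNIV. \<gamma> i * of_real (v $ i) * m i)"
      unfolding kac[symmetric] by (simp add: distrib_right sum.distrib sum_distrib_right)
    also have "\<dots> = (\<Sum>b\<in>UNIV. \<gamma> b * ((\<Sum>i\<in>UNIV. of_real ((mat h - Q) $ i $ b) * m i) + of_real (v $ b) * m b))"
      by (subst sum.swap) (simp add: distrib_left sum.distrib sum_distrib_left mult.assoc)
    also have "\<dots> = of_real \<rho> * E * of_real (h * (\<Sum>b\<in>UNIV. K.green b))"
      unfolding moment by (simp add: \<gamma>_def sum_distrib_left sum_distrib_right mult_ac)
    finally have m_a: "m a = of_real \<rho> * E * of_real (h * (\<Sum>b\<in>UNIV. K.green b))" .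
    have weight: "gauss_density Q h \<phi> * of_real (exp (- (v \<bullet> cmod2_vec (\<phi> + vec (of_real \<rho>))))) = K0 * exp (S \<phi>)" for \<phi>
      by (simp add: gauss_density_def K0_def S_def exp_diff exp_minus divide_inverse flip: exp_of_real)
    have "G.lhs_integrand (\<lambda>l. of_real (exp (- (v \<bullet> l)))) \<phi> = K0 / of_real \<rho> * ((\<phi> $ a + of_real \<rho>) * exp (S \<phi>))" for \<phi>
      unfolding G.lhs_integrand_def using weight[of \<phi>] by (simp add: mult_ac)
    then have 1: "(\<integral>\<phi>. G.lhs_integrand (\<lambda>l. of_real (exp (- (v \<bullet> l)))) \<phi> \<partial>lborel) = K0 / of_real \<rho> * m a"
      by (simp add: m_def)
    \<comment> \<open>The exponential turns the sum in its argument into a product, so the local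
      time decouples from the Gaussian variable.\<close>
    have "(\<integral>\<omega>. complex_of_real (exp (- (v \<bullet> (l + L \<omega>)))) \<partial>M) =
        of_real (exp (- (v \<bullet> l))) * of_real (h * (\<Sum>b\<in>UNIV. K.green b))" for l
    proof -
      have "(\<integral>\<omega>. complex_of_real (exp (- (v \<bullet> (l + L \<omega>)))) \<partial>M) =
          of_real (\<integral>\<omega>. exp (- (v \<bullet> l)) * exp (- (v \<bullet> L \<omega>)) \<partial>M)"
        by (simp add: inner_add_right flip: exp_add)
      also have "(\<integral>\<omega>. exp (- (v \<bullet> l)) * exp (- (v \<bullet> L \<omega>)) \<partial>M) = exp (- (v \<bullet> l)) * (h * (\<Sum>b\<in>UNIV. K.green b))"
        using K.expectation_weight_exponential_time[OF assms(5,6)] by (simp add: L_def)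
      finally show ?thesis by simp
    qed
    then have "G.rhs_integrand (\<lambda>l. of_real (exp (- (v \<bullet> l)))) \<phi> = of_real (h * (\<Sum>b\<in>UNIV. K.green b)) * K0 * exp (S \<phi>)" for \<phi>
      unfolding G.rhs_integrand_def using weight[of \<phi>] by (simp add: mult_ac)
    then have 2: "(\<integral>\<phi>. G.rhs_integrand (\<lambda>l. of_real (exp (- (v \<bullet> l)))) \<phi> \<partial>lborel) =
        of_real (h * (\<Sum>b\<in>UNIV. K.green b)) * K0 * E"
      by (simp add: E_def)
    \<comment> \<open>The \<rho> that the shift contributes to \<open>m a\<close> cancels the
      denominator on the left-hand side.\<close>
    show ?thesis
      unfolding G.defect_def 1 2 m_a using \<rho> by simp
  qed
  then have "G.defect u = 0"
    using G.defect_eq_0 property_F_continuous[OF assms(7)] property_F_decay[OF assms(7)] by blast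
  then show ?thesis
    unfolding G.defect_def right_minus_eq
    unfolding G.lhs_integrand_def G.rhs_integrand_def gauss_integral_def
    unfolding \<rho>_def L_def .
qed

end
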